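(* Every extremal tree is either a tree of stars or a path with an odd number of edges.
   Context: All graphs are finite, simple, undirected. For a graph $G$, $F(G)$ denotes the number of stable (independent) sets of $G$, including the empty set, and $\alpha(G)$ is the stability number (maximum size of a stable set). A tree $T$ is extremal if $F(T)$ is minimum among all trees with $|V(T)|$ vertices and stability number $\alpha(T)$. A leaf of a tree is a vertex of degree at most $1$ (so the single vertex of a one-vertex tree is a leaf). Trees of stars are defined inductively: a single vertex is a tree of stars; if $T_1,\dots,T_k$ ($k\ge 2$) are disjoint trees of stars and $v_i$ is a leaf of $T_i$ for each $i$, then the tree obtained from $T_1\cup\dots\cup T_k$ by adding a new vertex $w$ adjacent to every $v_i$ is a tree of stars. *)

theory Defs
  imports Main
begin

text \<open>
  A graph is given by its vertex set \<open>V\<close> and its set \<open>E\<close> of edges, an edge being the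
  two-element set of its endpoints. (The notion of tree for digraphs in the AFP entry
  \<open>Graph_Theory\<close> is not suitable here: in a symmetric digraph the closed walk
  \<open>a, b, a\<close> counts as a cycle.)
\<close>

definition simple_graph :: "'a set \<Rightarrow> 'a set set \<Rightarrow> bool" where
  "simple_graph V E \<longleftrightarrow> finite V \<and> (\<forall>e\<in>E. e \<subseteq> V \<and> card e = 2)"

definition adjacent :: "'a set set \<Rightarrow> 'a \<Rightarrow> 'a \<Rightarrow> bool" where
  "adjacent E u v \<longleftrightarrow> {u, v} \<in> E"

definition degree :: "'a set set \<Rightarrow> 'a \<Rightarrow> nat" where
  "degree E v = card {e \<in> E. v \<in> e}"

definition connected_graph :: "'a set \<Rightarrow> 'a set set \<Rightarrow> bool" where
  "connected_graph V E \<longleftrightarrow> V \<noteq> {} \<and> (\<forall>u\<in>V. \<forall>v\<in>V. (adjacent E)\<^sup>*\<^sup>* u v)"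

definition is_cycle :: "'a set set \<Rightarrow> 'a list \<Rightarrow> bool" where
  "is_cycle E xs \<longleftrightarrow>
     3 \<le> length xs \<and> distinct xs \<and> successively (adjacent E) xs \<and> adjacent E (last xs) (hd xs)"

definition tree :: "'a set \<Rightarrow> 'a set set \<Rightarrow> bool" where
  "tree V E \<longleftrightarrow> simple_graph V E \<and> connected_graph V E \<and> \<not> (\<exists>xs. is_cycle E xs)"

definition stable_sets :: "'a set \<Rightarrow> 'a set set \<Rightarrow> 'a set set" where
  "stable_sets V E = {S. S \<subseteq> V \<and> (\<forall>u\<in>S. \<forall>v\<in>S. \<not> adjacent E u v)}"

definition num_stable_sets :: "'a set \<Rightarrow> 'a set set \<Rightarrow> nat" where
  "num_stable_sets V E = card (stable_sets V E)"

definition stability_number :: "'a set \<Rightarrow> 'a set set \<Rightarrow> nat" where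
  "stability_number V E = Max (card ` stable_sets V E)"

text \<open>
  Comparing only with trees whose vertices come from the same type \<open>'a\<close> is no restriction:
  every graph with \<open>card V\<close> vertices is isomorphic to one on the vertex set \<open>V\<close> itself.
\<close>

definition extremal_tree :: "'a set \<Rightarrow> 'a set set \<Rightarrow> bool" where
  "extremal_tree V E \<longleftrightarrow> tree V E \<and>
     (\<forall>(V' :: 'a set) E'. tree V' E' \<and> card V' = card V \<and>
        stability_number V' E' = stability_number V E \<longrightarrow>
        num_stable_sets V E \<le> num_stable_sets V' E')"

definition leaf :: "'a set \<Rightarrow> 'a set set \<Rightarrow> 'a \<Rightarrow> bool" where
  "leaf V E v \<longleftrightarrow> v \<in> V \<and> degree E v \<le> 1"

inductive tree_of_stars :: "'a set \<Rightarrow> 'a set set \<Rightarrow> bool" where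
  single: "tree_of_stars {x} {}"
| join:
  "2 \<le> (k :: nat) \<Longrightarrow>
   (\<And>i. i < k \<Longrightarrow> tree_of_stars (VS i) (ES i)) \<Longrightarrow>
   (\<And>i j. i < k \<Longrightarrow> j < k \<Longrightarrow> i \<noteq> j \<Longrightarrow> VS i \<inter> VS j = {}) \<Longrightarrow>
   (\<And>i. i < k \<Longrightarrow> leaf (VS i) (ES i) (v i)) \<Longrightarrow>
   w \<notin> (\<Union>i<k. VS i) \<Longrightarrow>
   tree_of_stars (insert w (\<Union>i<k. VS i)) ((\<Union>i<k. ES i) \<union> (\<lambda>i. {w, v i}) ` {..<k})"

definition path_graph :: "'a set \<Rightarrow> 'a set set \<Rightarrow> bool" where
  "path_graph V E \<longleftrightarrow> (\<exists>xs. xs \<noteq> [] \<and> distinct xs \<and> V = set xs \<and>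
     E = {{xs ! i, xs ! Suc i} | i. Suc i < length xs})"

end

theory Submission
  imports Defs Complex_Main
begin

text \<open>
  Write \<open>F\<close> for the number of stable sets. If an edge \<open>uv\<close> joins the subtrees \<open>U\<close> and \<open>W\<close>, then
  \<open>F(T) = F(U) F(W) - F(U - N[u]) F(W - N[v])\<close>, so in an extremal tree \<open>u\<close> maximises
  \<open>F(U - N[u])\<close> among the vertices of \<open>U\<close> to which \<open>v\<close> can be reattached without changing the
  stability number. Which vertices these are depends only on which ones are core, that is, lie in
  all maximum stable sets of \<open>U\<close> or \<open>W\<close>. A leaf lies in at least a third of all stable
  sets, hence so does every unrestricted maximiser; but a vertex with two such branches lies in at
  most \<open>4/13\<close> of them. This forces the tree to be a path with a perfect matching as soon as
  some edge has both or neither of its endpoints core. Otherwise core and non-core vertices form a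
  bipartition in which the non-core ones have degree at least two, and the tree is a tree of stars
  provided the core ones have degree at most two. A core vertex of degree three is excluded by
  comparing three ways of moving a branch.
\<close>

text \<open>Joining two subtrees by an edge costs one in the stability number exactly when both
  endpoints are core, which is why only core status restricts a move. The constant
  \<open>4/13\<close> comes from two children each absent from at most \<open>2/3\<close> of the
  stable sets of its branch: the stable sets with and without the root are then in ratio at most
  \<open>4 : 9\<close>, whereas a share of a third means at least \<open>1 : 2\<close>. Moving a
  branch away from a core vertex is unrestricted in the oriented case, so a core vertex has a share
  of a third seen from every neighbour. But a replacement for one of its neighbours, inside that
  neighbour's own branch, has to be non-core. A leaf may be core, so it need not be an admissible
  rival and no such share is guaranteed for the neighbours. This is the obstacle to excluding three
  branches at a core vertex, and the reason why exact odds replace fixed fractions there.\<close>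

lemma adjacent_sym: "adjacent E u v \<Longrightarrow> adjacent E v u"
  by (simp add: adjacent_def insert_commute)

lemma adjacent_rtranclp_sym:
  assumes "(adjacent E)\<^sup>*\<^sup>* u v" shows "(adjacent E)\<^sup>*\<^sup>* v u"
  using assms
proof (induction rule: rtranclp_induct)
  case (step y z)
  from adjacent_sym[OF step.hyps(2)] step.IH show ?case by (rule converse_rtranclp_into_rtranclp)
qed simp

lemma adjacent_rtranclp_mono:
  assumes "E \<subseteq> E'" "(adjacent E)\<^sup>*\<^sup>* u v" shows "(adjacent E')\<^sup>*\<^sup>* u v"
proof -
  have "adjacent E \<le> adjacent E'" using assms(1) by (auto simp: adjacent_def)
  from rtranclp_mono[OF this] show ?thesis using assms(2) by auto
qed

lemma adjacent_simple_graph: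
  assumes "simple_graph V E" "adjacent E u v"
  shows "u \<in> V" "v \<in> V" "u \<noteq> v"
  using assms by (fastforce simp: simple_graph_def adjacent_def)+

section \<open>Trees and bridges\<close>

text \<open>Acyclicity in the form used throughout: it passes to subgraphs at once, and the
  components left after deleting an edge are the branches that get moved.\<close>

definition bridges :: "'a set set \<Rightarrow> bool" where
  "bridges E \<longleftrightarrow> (\<forall>u v. adjacent E u v \<longrightarrow> \<not> (adjacent (E - {{u, v}}))\<^sup>*\<^sup>* u v)"

lemma bridges_mono:
  assumes "bridges E" "E' \<subseteq> E" shows "bridges E'"
  unfolding bridges_def
proof (intro allI impI notI)
  fix u v assume uv: "adjacent E' u v" and *: "(adjacent (E' - {{u, v}}))\<^sup>*\<^sup>* u v"
  have "(adjacent (E - {{u, v}}))\<^sup>*\<^sup>* u v"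
    by (rule adjacent_rtranclp_mono[OF _ *]) (use assms(2) in blast)
  then show False using assms uv unfolding bridges_def adjacent_def by blast
qed

lemma rtranclp_imp_distinct_path:
  assumes "r\<^sup>*\<^sup>* u v"
  shows "\<exists>xs. xs \<noteq> [] \<and> distinct xs \<and> hd xs = u \<and> last xs = v \<and> successively r xs"
  using assms
proof (induction rule: rtranclp_induct)
  case base
  show ?case by (rule exI[of _ "[u]"]) simp
next
  case (step y z)
  then obtain xs where xs: "xs \<noteq> []" "distinct xs" "hd xs = u" "last xs = y" "successively r xs"
    by blast
  show ?case
  proof (cases "z \<in> set xs")
    case True
    then obtain as bs where ab: "xs = as @ z # bs" by (auto simp: in_set_conv_decomp)
    show ?thesis
      by (rule exI[of _ "as @ [z]"])
        (use xs ab in \<open>auto simp: successively_append_iff hd_append split: if_splits\<close>)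
  next
    case False
    show ?thesis
      by (rule exI[of _ "xs @ [z]"])
        (use xs False step.hyps(2) in \<open>auto simp: successively_append_iff\<close>)
  qed
qed

lemma successively_imp_rtranclp:
  "successively r xs \<Longrightarrow> xs \<noteq> [] \<Longrightarrow> r\<^sup>*\<^sup>* (hd xs) (last xs)"
proof (induction xs)
  case (Cons x xs)
  show ?case
  proof (cases xs)
    case (Cons y ys)
    then show ?thesis using Cons.IH Cons.prems
      by (auto intro: converse_rtranclp_into_rtranclp)
  qed simp
qed simp

text \<open>A walk between the ends of a deleted edge can be taken with distinct vertices, so the
  edge closes it to a cycle; conversely a cycle without its closing edge is such a walk.\<close>

lemma acyclic_iff_bridges:
  assumes sg: "simple_graph V E"
  shows "\<not> (\<exists>xs. is_cycle E xs) \<longleftrightarrow> bridges E"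
proof
  assume nc: "\<not> (\<exists>xs. is_cycle E xs)"
  show "bridges E"
    unfolding bridges_def
  proof (intro allI impI notI)
    fix u v assume uv: "adjacent E u v" and *: "(adjacent (E - {{u, v}}))\<^sup>*\<^sup>* u v"
    from rtranclp_imp_distinct_path[OF *] obtain xs where xs: "xs \<noteq> []" "distinct xs" "hd xs = u"
      "last xs = v" "successively (adjacent (E - {{u, v}})) xs" by blast
    have "u \<noteq> v" using adjacent_simple_graph[OF sg uv] by simp
    \<comment> \<open>Length one would give \<open>u = v\<close>, and length two would use the
      deleted edge itself.\<close>
    have "3 \<le> length xs"
    proof (rule ccontr)
      assume "\<not> 3 \<le> length xs"
      then have "length xs = 1 \<or> length xs = 2"
        using xs(1) length_greater_0_conv[of xs] by linarith
      then show False
      proof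
        assume "length xs = 1"
        then show False using xs \<open>u \<noteq> v\<close> by (auto simp: length_Suc_conv)
      next
        assume "length xs = 2"
        then obtain a b where "xs = [a, b]" by (auto simp: length_Suc_conv numeral_2_eq_2)
        then show False using xs by (auto simp: adjacent_def)
      qed
    qed
    moreover have "successively (adjacent E) xs"
      using xs(5) by (rule successively_mono) (auto simp: adjacent_def)
    ultimately have "is_cycle E xs"
      using xs uv by (auto simp: is_cycle_def intro: adjacent_sym)
    then show False using nc by blast
  qed
next
  assume br: "bridges E"
  show "\<not> (\<exists>xs. is_cycle E xs)"
  proof
    assume "\<exists>xs. is_cycle E xs"
    then obtain xs where xs: "3 \<le> length xs" "distinct xs" "successively (adjacent E) xs"
      "adjacent E (last xs) (hd xs)" by (auto simp: is_cycle_def)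
    let ?e = "{hd xs, last xs}"
    have ne: "xs \<noteq> []" using xs(1) by auto
    have "successively (adjacent (E - {?e})) xs"
      unfolding successively_conv_nth
    proof (intro allI impI)
      fix i assume i: "Suc i < length xs"
      have "{xs ! i, xs ! Suc i} \<in> E"
        using xs(3) i by (auto simp: successively_conv_nth adjacent_def)
      moreover have "{xs ! i, xs ! Suc i} \<noteq> ?e"
        using i xs(1,2) ne
        by (auto simp: doubleton_eq_iff hd_conv_nth last_conv_nth nth_eq_iff_index_eq)
      ultimately show "adjacent (E - {?e}) (xs ! i) (xs ! Suc i)" by (simp add: adjacent_def)
    qed
    from successively_imp_rtranclp[OF this ne] adjacent_sym[OF xs(4)] br
    show False unfolding bridges_def by blast
  qed
qed

lemma tree_iff_bridges: "tree V E \<longleftrightarrow> simple_graph V E \<and> connected_graph V E \<and> bridges E"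
  unfolding tree_def using acyclic_iff_bridges by blast

lemma rtranclp_map:
  assumes "r\<^sup>*\<^sup>* a b" and "\<And>x y. r x y \<Longrightarrow> f x = f y \<or> q (f x) (f y)"
  shows "q\<^sup>*\<^sup>* (f a) (f b)"
  using assms(1)
proof (induction rule: rtranclp_induct)
  case (step y z)
  from assms(2)[OF step.hyps(2)] step.IH show ?case
    by (auto intro: rtranclp.rtrancl_into_rtrancl)
qed simp

text \<open>Collapsing one side of the new edge onto its endpoint maps walks to walks, so an edge of
  the other side stays a bridge.\<close>

lemma join_bridge_left:
  assumes sg: "simple_graph V1 E1" "simple_graph V2 E2" and dj: "V1 \<inter> V2 = {}"
    and u: "u \<in> V1" "v \<in> V2" and b: "bridges E1" and ab: "adjacent E1 a b"
  shows "\<not> (adjacent (insert {u, v} (E1 \<union> E2) - {{a, b}}))\<^sup>*\<^sup>* a b"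
proof
  assume *: "(adjacent (insert {u, v} (E1 \<union> E2) - {{a, b}}))\<^sup>*\<^sup>* a b"
  define f where "f x = (if x \<in> V1 then x else u)" for x
  have "f x = f y \<or> adjacent (E1 - {{a, b}}) (f x) (f y)"
    if "adjacent (insert {u, v} (E1 \<union> E2) - {{a, b}}) x y" for x y
  proof -
    from that have ne: "{x, y} \<noteq> {a, b}"
      and "{x, y} = {u, v} \<or> {x, y} \<in> E1 \<or> {x, y} \<in> E2"
      by (auto simp: adjacent_def)
    then consider "{x, y} = {u, v}" | "{x, y} \<in> E1" | "{x, y} \<in> E2" by blast
    then show ?thesis
    proof cases
      case 1
      have "v \<notin> V1" using dj u by blast
      then show ?thesis using 1 u by (auto simp: doubleton_eq_iff f_def)
    next
      case 2
      then have "x \<in> V1" "y \<in> V1" using sg(1) by (auto simp: simple_graph_def)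
      then show ?thesis using 2 ne by (simp add: f_def adjacent_def)
    next
      case 3
      then have "x \<in> V2" "y \<in> V2" using sg(2) by (auto simp: simple_graph_def)
      then have "x \<notin> V1" "y \<notin> V1" using dj by auto
      then show ?thesis by (simp add: f_def)
    qed
  qed
  from rtranclp_map[where f = f and q = "adjacent (E1 - {{a, b}})", OF * this]
  have "(adjacent (E1 - {{a, b}}))\<^sup>*\<^sup>* a b"
    using adjacent_simple_graph[OF sg(1) ab] by (simp add: f_def)
  then show False using b ab unfolding bridges_def by blast
qed

text \<open>Certifies in \<open>move\<close> that the rearranged graph is a tree. The new edge is a
  bridge because without it no step leaves \<open>V1\<close>.\<close>

lemma tree_join:
  assumes t: "tree V1 E1" "tree V2 E2" and dj: "V1 \<inter> V2 = {}" and u: "u \<in> V1" "v \<in> V2"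
  shows "tree (V1 \<union> V2) (insert {u, v} (E1 \<union> E2))"
proof -
  let ?E = "insert {u, v} (E1 \<union> E2)"
  have sg: "simple_graph V1 E1" "simple_graph V2 E2" and b: "bridges E1" "bridges E2"
    and c: "connected_graph V1 E1" "connected_graph V2 E2"
    using t by (auto simp: tree_iff_bridges)
  have "u \<noteq> v" using dj u by auto
  have "simple_graph (V1 \<union> V2) ?E"
    using sg u \<open>u \<noteq> v\<close> by (auto simp: simple_graph_def)
  moreover have "connected_graph (V1 \<union> V2) ?E"
  proof -
    have "(adjacent ?E)\<^sup>*\<^sup>* w u" if "w \<in> V1 \<union> V2" for w
    proof (cases "w \<in> V1")
      case True
      then have "(adjacent E1)\<^sup>*\<^sup>* w u" using c u by (auto simp: connected_graph_def)
      then show ?thesis by (rule adjacent_rtranclp_mono[rotated]) auto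
    next
      case False
      then have "(adjacent E2)\<^sup>*\<^sup>* w v" using c u that by (auto simp: connected_graph_def)
      then have "(adjacent ?E)\<^sup>*\<^sup>* w v" by (rule adjacent_rtranclp_mono[rotated]) auto
      moreover have "adjacent ?E v u" by (auto simp: adjacent_def)
      ultimately show ?thesis by (rule rtranclp.rtrancl_into_rtrancl)
    qed
    then have "(adjacent ?E)\<^sup>*\<^sup>* w w'" if "w \<in> V1 \<union> V2" "w' \<in> V1 \<union> V2" for w w'
      using that by (meson adjacent_rtranclp_sym rtranclp_trans)
    then show ?thesis using u by (auto simp: connected_graph_def)
  qed
  moreover have "bridges ?E"
    unfolding bridges_def
  proof (intro allI impI)
    fix a b' assume ab: "adjacent ?E a b'"
    then consider "{a, b'} = {u, v}" | "adjacent E1 a b'" | "adjacent E2 a b'"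
      by (auto simp: adjacent_def)
    then show "\<not> (adjacent (?E - {{a, b'}}))\<^sup>*\<^sup>* a b'"
    proof cases
      case 1
      have "w' \<in> V1 \<longleftrightarrow> w \<in> V1" if "(adjacent (?E - {{u, v}}))\<^sup>*\<^sup>* w w'" for w w'
        using that
      proof (induction rule: rtranclp_induct)
        case (step y z)
        then have "{y, z} \<in> E1 \<or> {y, z} \<in> E2" by (auto simp: adjacent_def)
        then show ?case using step.IH sg dj by (fastforce simp: simple_graph_def)
      qed simp
      then show ?thesis using 1 u dj by (metis disjoint_iff doubleton_eq_iff)
    next
      case 2
      then show ?thesis using join_bridge_left[OF sg dj u b(1)] by blast
    next
      case 3
      have "insert {u, v} (E1 \<union> E2) = insert {v, u} (E2 \<union> E1)" by auto
      then show ?thesis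
        using join_bridge_left[OF sg(2,1) _ u(2,1) b(2) 3] dj by auto
    qed
  qed
  ultimately show ?thesis by (simp add: tree_iff_bridges)
qed

section \<open>Counting stable sets\<close>

text \<open>Subgraphs are vertex sets with \<open>E\<close> fixed, and no ambient vertex set is
  required, so the same counting lemmas serve both the given tree and the rearranged one.\<close>

locale loopfree =
  fixes E :: "'a set set"
  assumes irrefl: "\<not> adjacent E v v"
begin

abbreviation F :: "'a set \<Rightarrow> nat" where "F W \<equiv> num_stable_sets W E"
abbreviation al :: "'a set \<Rightarrow> nat" where "al W \<equiv> stability_number W E"
definition nb :: "'a \<Rightarrow> 'a set" where "nb v = {w. adjacent E v w}"

definition separated :: "'a set \<Rightarrow> 'a set \<Rightarrow> bool" where
  "separated X Y \<longleftrightarrow> X \<inter> Y = {} \<and> (\<forall>a\<in>X. \<forall>b\<in>Y. \<not> adjacent E a b)"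

text \<open>For \<open>v \<in> W\<close>: every maximum stable set of the subgraph induced on \<open>W\<close> contains \<open>v\<close>.\<close>

definition core :: "'a set \<Rightarrow> 'a \<Rightarrow> bool" where
  "core W v \<longleftrightarrow> al (W - {v}) < al W"

lemma mem_nb [simp]: "w \<in> nb v \<longleftrightarrow> adjacent E v w"
  by (simp add: nb_def)

lemma separated_subset: "separated X Y \<Longrightarrow> X' \<subseteq> X \<Longrightarrow> Y' \<subseteq> Y \<Longrightarrow> separated X' Y'"
  unfolding separated_def by blast

lemma finite_stable_sets: "finite W \<Longrightarrow> finite (stable_sets W E)"
  by (rule finite_subset[of _ "Pow W"]) (auto simp: stable_sets_def)

text \<open>Dropping the forced vertices \<open>A\<close> is undone by adding them back. One count
  covers both the deletion recursion and the four membership patterns in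
  \<open>same_side_correlation\<close>.\<close>

lemma card_stable_sets_constrained:
  assumes "finite W" "A \<subseteq> W" "A \<in> stable_sets W E" "A \<inter> B = {}"
  shows "card {S \<in> stable_sets W E. A \<subseteq> S \<and> S \<inter> B = {}} = F (W - A - B - (\<Union>a\<in>A. nb a))"
proof -
  let ?L = "{S \<in> stable_sets W E. A \<subseteq> S \<and> S \<inter> B = {}}"
  let ?R = "stable_sets (W - A - B - (\<Union>a\<in>A. nb a)) E"
  have "bij_betw (\<lambda>S. S - A) ?L ?R"
  proof (rule bij_betw_byWitness[where f' = "\<lambda>S. S \<union> A"])
    show "(\<lambda>S. S - A) ` ?L \<subseteq> ?R"
      by (auto simp: stable_sets_def)
    show "(\<lambda>S. S \<union> A) ` ?R \<subseteq> ?L"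
    proof (rule image_subsetI)
      fix S assume S: "S \<in> ?R"
      then have "\<not> adjacent E u v" if "u \<in> S \<union> A" "v \<in> S \<union> A" for u v
        using that assms(3) adjacent_sym[of E u v] by (auto simp: stable_sets_def)
      then show "S \<union> A \<in> ?L" using S assms(2,4) by (auto simp: stable_sets_def)
    qed
  qed (auto simp: stable_sets_def)
  then show ?thesis unfolding num_stable_sets_def by (rule bij_betw_same_card)
qed

lemma F_rec:
  assumes "finite W" "v \<in> W"
  shows "F W = F (W - {v}) + F (W - {v} - nb v)"
proof -
  have v: "{v} \<in> stable_sets W E" using assms irrefl by (auto simp: stable_sets_def)
  have "stable_sets W E = {S \<in> stable_sets W E. {} \<subseteq> S \<and> S \<inter> {v} = {}}
      \<union> {S \<in> stable_sets W E. {v} \<subseteq> S \<and> S \<inter> {} = {}}" by auto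
  then have "card (stable_sets W E) = card {S \<in> stable_sets W E. {} \<subseteq> S \<and> S \<inter> {v} = {}}
      + card {S \<in> stable_sets W E. {v} \<subseteq> S \<and> S \<inter> {} = {}}"
    using finite_stable_sets[OF assms(1)]
    by (subst card_Un_disjoint[symmetric]) auto
  also have "card {S \<in> stable_sets W E. {} \<subseteq> S \<and> S \<inter> {v} = {}} = F (W - {v})"
    by (subst card_stable_sets_constrained) (use assms in \<open>auto simp: stable_sets_def\<close>)
  also have "card {S \<in> stable_sets W E. {v} \<subseteq> S \<and> S \<inter> {} = {}} = F (W - {v} - nb v)"
    by (subst card_stable_sets_constrained) (use assms v in auto)
  finally show ?thesis by (simp add: num_stable_sets_def)
qed

lemma F_mono: "finite Y \<Longrightarrow> X \<subseteq> Y \<Longrightarrow> F X \<le> F Y"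
  unfolding num_stable_sets_def
  by (rule card_mono) (auto simp: finite_stable_sets, auto simp: stable_sets_def)

lemma F_pos: "finite W \<Longrightarrow> 0 < F W"
  unfolding num_stable_sets_def
  by (subst card_gt_0_iff) (auto simp: finite_stable_sets, auto simp: stable_sets_def)

lemma F_le_double:
  assumes "finite W"
  shows "F W \<le> 2 * F (W - {v})"
proof (cases "v \<in> W")
  case True
  then show ?thesis
    using F_rec[OF assms True] F_mono[of "W - {v}" "W - {v} - nb v"] assms by auto
qed simp

lemma stable_sets_Un:
  assumes "separated X Y"
  shows "bij_betw (\<lambda>(S, S'). S \<union> S') (stable_sets X E \<times> stable_sets Y E) (stable_sets (X \<union> Y) E)"
proof (rule bij_betw_byWitness[where f' = "\<lambda>S. (S \<inter> X, S \<inter> Y)"])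
  have "S \<union> S' \<in> stable_sets (X \<union> Y) E" if S: "S \<in> stable_sets X E" "S' \<in> stable_sets Y E" for S S'
  proof -
    have "\<not> adjacent E u v" if "u \<in> S \<union> S'" "v \<in> S \<union> S'" for u v
      using that S assms adjacent_sym[of E u v] unfolding stable_sets_def separated_def by blast
    then show ?thesis using S by (auto simp: stable_sets_def)
  qed
  then show "(\<lambda>(S, S'). S \<union> S') ` (stable_sets X E \<times> stable_sets Y E) \<subseteq> stable_sets (X \<union> Y) E"
    by auto
qed (use assms in \<open>auto simp: stable_sets_def separated_def\<close>)

lemma F_Un:
  assumes "separated X Y"
  shows "F (X \<union> Y) = F X * F Y"
  using bij_betw_same_card[OF stable_sets_Un[OF assms]]
  by (simp add: num_stable_sets_def card_cartesian_product)

lemma al_ge: "finite W \<Longrightarrow> S \<in> stable_sets W E \<Longrightarrow> card S \<le> al W"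
  unfolding stability_number_def by (rule Max_ge) (auto simp: finite_stable_sets)

lemma al_ex:
  assumes "finite W" obtains S where "S \<in> stable_sets W E" "card S = al W"
proof -
  have "{} \<in> stable_sets W E" by (simp add: stable_sets_def)
  then have "Max (card ` stable_sets W E) \<in> card ` stable_sets W E"
    by (intro Max_in) (use finite_stable_sets[OF assms] in auto)
  then show ?thesis using that by (auto simp: stability_number_def)
qed

lemma al_mono:
  assumes "finite Y" "X \<subseteq> Y"
  shows "al X \<le> al Y"
proof -
  obtain S where S: "S \<in> stable_sets X E" "card S = al X"
    using al_ex finite_subset[OF assms(2,1)] by metis
  then have "S \<in> stable_sets Y E" using assms(2) by (auto simp: stable_sets_def)
  from al_ge[OF assms(1) this] S(2) show ?thesis by simp
qed

lemma al_Un: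
  assumes "separated X Y" "finite X" "finite Y"
  shows "al (X \<union> Y) = al X + al Y"
proof (rule antisym)
  obtain S where S: "S \<in> stable_sets (X \<union> Y) E" "card S = al (X \<union> Y)"
    using al_ex[of "X \<union> Y"] assms by auto
  have "S = (S \<inter> X) \<union> (S \<inter> Y)" using S by (auto simp: stable_sets_def)
  then have "card S \<le> card (S \<inter> X) + card (S \<inter> Y)" by (metis card_Un_le)
  also have "card (S \<inter> X) \<le> al X" using S assms by (intro al_ge) (auto simp: stable_sets_def)
  also have "card (S \<inter> Y) \<le> al Y" using S assms by (intro al_ge) (auto simp: stable_sets_def)
  finally show "al (X \<union> Y) \<le> al X + al Y" using S by simp
next
  obtain S S' where S: "S \<in> stable_sets X E" "card S = al X" "S' \<in> stable_sets Y E" "card S' = al Y"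
    using al_ex assms(2,3) by metis
  have "S \<inter> S' = {}" "finite S" "finite S'" using S assms
    by (auto simp: stable_sets_def separated_def intro: finite_subset)
  then have "card (S \<union> S') = al X + al Y" using S by (simp add: card_Un_disjoint)
  moreover have "S \<union> S' \<in> stable_sets (X \<union> Y) E"
    using bij_betwE[OF stable_sets_Un[OF assms(1)]] S by auto
  ultimately show "al X + al Y \<le> al (X \<union> Y)" using al_ge[of "X \<union> Y"] assms by (metis finite_UnI)
qed

lemma al_rec:
  assumes "finite W" "v \<in> W"
  shows "al W = max (al (W - {v})) (Suc (al (W - {v} - nb v)))"
proof (rule antisym)
  obtain S where S: "S \<in> stable_sets W E" "card S = al W" using al_ex assms(1) by metis
  show "al W \<le> max (al (W - {v})) (Suc (al (W - {v} - nb v)))"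
  proof (cases "v \<in> S")
    case True
    have "S - {v} \<in> stable_sets (W - {v} - nb v) E" using S True by (auto simp: stable_sets_def)
    then have "card (S - {v}) \<le> al (W - {v} - nb v)" using assms by (intro al_ge) auto
    moreover have "card S = Suc (card (S - {v}))"
      using True S assms by (intro card.remove) (auto simp: stable_sets_def intro: finite_subset)
    ultimately show ?thesis using S by simp
  next
    case False
    then have "S \<in> stable_sets (W - {v}) E" using S by (auto simp: stable_sets_def)
    then show ?thesis using al_ge[of "W - {v}" S] assms S by simp
  qed
next
  obtain S where S: "S \<in> stable_sets (W - {v} - nb v) E" "card S = al (W - {v} - nb v)"
    using al_ex[of "W - {v} - nb v"] assms by auto
  have "insert v S \<in> stable_sets W E"
    using S assms irrefl adjacent_sym[of E _ v] unfolding stable_sets_def by auto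
  moreover have "card (insert v S) = Suc (card S)"
    using S assms by (subst card_insert_disjoint) (auto simp: stable_sets_def intro: finite_subset)
  ultimately have "Suc (al (W - {v} - nb v)) \<le> al W" using al_ge[OF assms(1)] S by metis
  then show "max (al (W - {v})) (Suc (al (W - {v} - nb v))) \<le> al W"
    using al_mono[OF assms(1), of "W - {v}"] by auto
qed

lemma al_delete:
  assumes "finite W" "v \<in> W"
  shows "al (W - {v}) \<le> al W" "al W \<le> Suc (al (W - {v}))"
    "al (W - {v} - nb v) \<le> al (W - {v})"
  using al_rec[OF assms] al_mono[of "W - {v}" "W - {v} - nb v"] assms by auto

lemma core_iff:
  assumes "finite W" "v \<in> W"
  shows "core W v \<longleftrightarrow> al (W - {v} - nb v) = al (W - {v})"
  using al_rec[OF assms] al_delete[OF assms] by (auto simp: core_def)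

lemma join_split:
  assumes "X \<inter> Y = {}" "u \<in> X" "v \<in> Y"
    and "\<And>a b. a \<in> X \<Longrightarrow> b \<in> Y \<Longrightarrow> adjacent E a b \<longleftrightarrow> a = u \<and> b = v"
  shows "X \<union> Y - {u} = (X - {u}) \<union> Y" "X \<union> Y - {u} - nb u = (X - {u} - nb u) \<union> (Y - {v})"
    "separated (X - {u}) Y" "separated (X - {u} - nb u) (Y - {v})"
  using assms by (auto simp: separated_def)

text \<open>A pair of stable sets of the two sides fails to give a stable set only when it uses both
  endpoints. For fixed sides, the product of these two counts is all that depends on the point of
  attachment.\<close>

lemma F_join:
  assumes fin: "finite X" "finite Y" and j: "X \<inter> Y = {}" "u \<in> X" "v \<in> Y"
    "\<And>a b. a \<in> X \<Longrightarrow> b \<in> Y \<Longrightarrow> adjacent E a b \<longleftrightarrow> a = u \<and> b = v"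
  shows "F (X \<union> Y) + F (X - {u} - nb u) * F (Y - {v} - nb v) = F X * F Y"
proof -
  have "F (X \<union> Y) = F (X - {u}) * F Y + F (X - {u} - nb u) * F (Y - {v})"
    using F_rec[of "X \<union> Y" u] fin j(2) join_split(1,2)[OF j] F_Un join_split(3,4)[OF j] by simp
  then show ?thesis
    using F_rec[OF fin(1) j(2)] F_rec[OF fin(2) j(3)] by (simp add: algebra_simps)
qed

text \<open>A side whose endpoint is not core has a maximum stable set avoiding that endpoint, so
  maximum stable sets of both sides can be united; one vertex is lost only if both endpoints are
  forced.\<close>

lemma al_join:
  assumes fin: "finite X" "finite Y" and j: "X \<inter> Y = {}" "u \<in> X" "v \<in> Y"
    "\<And>a b. a \<in> X \<Longrightarrow> b \<in> Y \<Longrightarrow> adjacent E a b \<longleftrightarrow> a = u \<and> b = v"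
  shows "al (X \<union> Y) + (if core X u \<and> core Y v then 1 else 0) = al X + al Y"
proof -
  have "al (X \<union> Y) = max (al (X - {u}) + al Y) (Suc (al (X - {u} - nb u) + al (Y - {v})))"
    using al_rec[of "X \<union> Y" u] fin j(2) join_split(1,2)[OF j] al_Un join_split(3,4)[OF j] by simp
  then show ?thesis
    using al_rec[OF fin(1) j(2)] al_delete[OF fin(1) j(2)] al_delete[OF fin(2) j(3)]
    by (auto simp: core_def)
qed

text \<open>By \<open>core_iff\<close> the question is whether deleting all neighbours of
  \<open>v\<close> from \<open>W - {v}\<close> lowers the stability number. Each neighbour lies in a
  branch separated from the other neighbours, so this can be tested one neighbour at a time.\<close>

lemma core_iff_branches:
  assumes fin: "finite W" and v: "v \<in> W"
    and B: "\<And>w. w \<in> nb v \<inter> W \<Longrightarrow>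
      w \<in> B w \<and> B w \<subseteq> W - {v} \<and> B w \<inter> nb v = {w} \<and> separated (B w) (W - {v} - B w)"
  shows "core W v \<longleftrightarrow> (\<forall>w\<in>nb v \<inter> W. \<not> core (B w) w)"
proof -
  \<comment> \<open>Whatever set \<open>M\<close> of other neighbours is already gone, deleting
    \<open>w\<close> has an effect only inside \<open>B w\<close>.\<close>
  have step: "al (W - {v} - insert w M) = al (W - {v} - M) \<longleftrightarrow> \<not> core (B w) w"
    if w: "w \<in> nb v \<inter> W" and M: "M \<subseteq> nb v \<inter> W" "w \<notin> M" for w M
  proof -
    have Bw: "w \<in> B w" "B w \<subseteq> W - {v}" "B w \<inter> nb v = {w}" "separated (B w) (W - {v} - B w)"
      using B[OF w] by auto
    then have fB: "finite (B w)" using fin finite_subset by blast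
    have "W - {v} - M = B w \<union> (W - {v} - B w - M)" using Bw M by auto
    moreover have "W - {v} - insert w M = (B w - {w}) \<union> (W - {v} - B w - M)" using Bw M by auto
    moreover have "separated (B w) (W - {v} - B w - M)" "separated (B w - {w}) (W - {v} - B w - M)"
      using separated_subset[OF Bw(4)] by auto
    ultimately have "al (W - {v} - M) = al (B w) + al (W - {v} - B w - M)"
      "al (W - {v} - insert w M) = al (B w - {w}) + al (W - {v} - B w - M)"
      using al_Un fB fin by simp_all
    then show ?thesis using al_delete(1)[OF fB Bw(1)] by (auto simp: core_def)
  qed
  let ?N = "nb v \<inter> W"
  have eq: "W - {v} - nb v = W - {v} - ?N" by auto
  show ?thesis
  proof
    assume "core W v"
    then have *: "al (W - {v} - ?N) = al (W - {v})" using core_iff[OF fin v] eq by simp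
    show "\<forall>w\<in>?N. \<not> core (B w) w"
    proof
      fix w assume w: "w \<in> ?N"
      have "al (W - {v} - ?N) \<le> al (W - {v} - {w})" "al (W - {v} - {w}) \<le> al (W - {v})"
        using w fin by (auto intro!: al_mono)
      then have "al (W - {v} - {w}) = al (W - {v} - {})" using * by simp
      then show "\<not> core (B w) w" using step[OF w, of "{}"] by simp
    qed
  next
    assume *: "\<forall>w\<in>?N. \<not> core (B w) w"
    have "finite ?N" using fin by simp
    have "M \<subseteq> ?N \<Longrightarrow> al (W - {v} - M) = al (W - {v})" if "finite M" for M
      using that
    proof (induction M rule: finite_induct)
      case (insert w M)
      then show ?case using step[of w M] * by auto
    qed simp
    from this[OF \<open>finite ?N\<close>] show "core W v" using core_iff[OF fin v] eq by simp
  qed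
qed

text \<open>Forcing \<open>l\<close> into a stable set excludes at most the one further vertex
  \<open>p\<close>, and deleting one vertex at most halves the count. The share of \<open>l\<close>
  is thus at least \<open>1/(1 + 2)\<close>.\<close>

lemma leaf_in_third:
  assumes "finite W" "l \<in> W" "nb l \<inter> W \<subseteq> {p}"
  shows "F (W - {l}) \<le> 2 * F (W - {l} - nb l)"
proof (cases "p \<in> nb l \<inter> W")
  case True
  then have "W - {l} - nb l = W - {l} - {p}" using assms by auto
  then show ?thesis using F_le_double[of "W - {l}" p] assms by simp
next
  case False
  then have "W - {l} - nb l = W - {l}" using assms by auto
  then show ?thesis by simp
qed

text \<open>In a stable set containing \<open>p\<close>, the leaf \<open>l\<close> can take its
  place. This makes \<open>p\<close> an admissible target when a branch must stay attached to a
  non-core vertex.\<close>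

lemma leaf_support_not_core:
  assumes "finite W" "l \<in> W" "p \<in> W" "nb l \<inter> W = {p}"
  shows "\<not> core W p"
proof -
  have lp: "adjacent E l p" and l: "\<And>x. x \<in> W \<Longrightarrow> adjacent E l x \<Longrightarrow> x = p"
    using assms(4) mem_nb by blast+
  have "l \<noteq> p" using lp irrefl by blast
  have "W - {p} - {l} \<supseteq> W - {p} - nb p" using adjacent_sym[OF lp] mem_nb by blast
  have e: "W - {p} - {l} - nb l = W - {p} - {l}" using l mem_nb by blast
  have "al (W - {p}) = Suc (al (W - {p} - {l}))"
    using al_rec[of "W - {p}" l] assms(1,2) \<open>l \<noteq> p\<close> e by simp
  moreover have "al (W - {p} - nb p) \<le> al (W - {p} - {l})"
    using assms(1) \<open>W - {p} - {l} \<supseteq> W - {p} - nb p\<close> by (intro al_mono) auto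
  ultimately show ?thesis using core_iff[OF assms(1,3)] by simp
qed

text \<open>Same-side vertices of a bipartite graph are positively correlated: in a pair \<open>(S, S')\<close> with
  \<open>p \<in> S - S'\<close> and \<open>y \<in> S' - S\<close>, swap \<open>S\<close> and \<open>S'\<close> on the component of \<open>y\<close> in
  the subgraph induced on the symmetric difference. Along that component membership in \<open>S'\<close>
  follows the bipartition, so it does not contain \<open>p\<close>.\<close>

definition swap_component :: "'a \<Rightarrow> 'a set \<Rightarrow> 'a set" where
  "swap_component y D = {v. (\<lambda>a b. a \<in> D \<and> b \<in> D \<and> adjacent E a b)\<^sup>*\<^sup>* y v}"

lemma swap_component_closed:
  "a \<in> swap_component y D \<Longrightarrow> a \<in> D \<Longrightarrow> b \<in> D \<Longrightarrow> adjacent E a b \<Longrightarrow> b \<in> swap_component y D"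
  unfolding swap_component_def mem_Collect_eq by (erule rtranclp.rtrancl_into_rtrancl) simp

lemma swap_component_subset:
  assumes "y \<in> D" shows "swap_component y D \<subseteq> D"
proof
  fix v assume "v \<in> swap_component y D"
  then show "v \<in> D" using assms unfolding swap_component_def mem_Collect_eq
    by (induction rule: rtranclp_induct) auto
qed

lemma swap_component_stable:
  assumes S: "S \<in> stable_sets W E" "S' \<in> stable_sets W E"
    and D: "D = (S - S') \<union> (S' - S)" and y: "y \<in> D"
  shows "(S - swap_component y D) \<union> (S' \<inter> swap_component y D) \<in> stable_sets W E"
proof -
  let ?K = "swap_component y D"
  have K: "?K \<subseteq> D" using swap_component_subset[OF y] .
  \<comment> \<open>Such an edge would put \<open>a\<close> into the symmetric difference and hence
    into the component of \<open>b\<close>.\<close>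
  have cross: "\<not> adjacent E a b" if "a \<in> S - ?K" "b \<in> S' \<inter> ?K" for a b
  proof
    assume "adjacent E a b"
    note that = that this
    have "a \<notin> S'" using that S(2) by (auto simp: stable_sets_def)
    then have "a \<in> D" using that D by blast
    moreover have "b \<in> D" using that K by blast
    ultimately show False
      using swap_component_closed[of b y D a] that(1,2) adjacent_sym[OF that(3)] by blast
  qed
  have "\<not> adjacent E a b"
    if ab: "a \<in> (S - ?K) \<union> (S' \<inter> ?K)" "b \<in> (S - ?K) \<union> (S' \<inter> ?K)" for a b
  proof (cases "a \<in> ?K \<longleftrightarrow> b \<in> ?K")
    case True
    then have "a \<in> S \<and> b \<in> S \<or> a \<in> S' \<and> b \<in> S'" using ab by blast
    then show ?thesis using S by (auto simp: stable_sets_def)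
  next
    case False
    then consider "a \<in> S - ?K" "b \<in> S' \<inter> ?K" | "b \<in> S - ?K" "a \<in> S' \<inter> ?K" using ab by blast
    then show ?thesis using cross[of a b] cross[of b a] adjacent_sym[of E a b] by cases auto
  qed
  moreover have "(S - ?K) \<union> (S' \<inter> ?K) \<subseteq> W" using S unfolding stable_sets_def by blast
  ultimately show ?thesis unfolding stable_sets_def mem_Collect_eq by blast
qed

lemma swap_component_alternates:
  assumes S: "S \<in> stable_sets W E" "S' \<in> stable_sets W E"
    and D: "D = (S - S') \<union> (S' - S)"
    and bip: "\<And>a b. a \<in> W \<Longrightarrow> b \<in> W \<Longrightarrow> adjacent E a b \<Longrightarrow> a \<in> A \<longleftrightarrow> b \<notin> A"
    and y: "y \<in> S' - S" "y \<in> A" and v: "v \<in> swap_component y D"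
  shows "v \<in> S' \<longleftrightarrow> v \<in> A"
proof -
  have "v \<in> D \<and> (v \<in> S' \<longleftrightarrow> v \<in> A)"
    using v unfolding swap_component_def mem_Collect_eq
  proof (induction rule: rtranclp_induct)
    case base
    then show ?case using y D by auto
  next
    case (step a b)
    then have ab: "a \<in> D" "b \<in> D" "adjacent E a b" by auto
    then have "a \<in> W" "b \<in> W" using S D by (auto simp: stable_sets_def)
    moreover have "b \<in> S' \<longleftrightarrow> a \<notin> S'" using ab S D by (auto simp: stable_sets_def)
    ultimately show ?case using bip[of a b] ab step.IH by blast
  qed
  then show ?thesis ..
qed

lemma same_side_correlation:
  assumes fin: "finite W" and p: "p \<in> W" "p \<in> A" and y: "y \<in> W" "y \<in> A" and "p \<noteq> y"
    and bip: "\<And>a b. a \<in> W \<Longrightarrow> b \<in> W \<Longrightarrow> adjacent E a b \<Longrightarrow> a \<in> A \<longleftrightarrow> b \<notin> A"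
  shows "F (W - {p, y} - nb p) * F (W - {p, y} - nb y)
    \<le> F (W - {p, y} - nb p - nb y) * F (W - {p, y})"
proof -
  let ?S = "\<lambda>I J. {S \<in> stable_sets W E. I \<subseteq> S \<and> S \<inter> J = {}}"
  have st: "{p} \<in> stable_sets W E" "{y} \<in> stable_sets W E" "{p, y} \<in> stable_sets W E"
    "{} \<in> stable_sets W E"
    using p y irrefl bip by (auto simp: stable_sets_def)
  have e: "W - {p} - {y} - (\<Union>a\<in>{p}. nb a) = W - {p, y} - nb p"
    "W - {y} - {p} - (\<Union>a\<in>{y}. nb a) = W - {p, y} - nb y"
    "W - {p, y} - {} - (\<Union>a\<in>{p, y}. nb a) = W - {p, y} - nb p - nb y"
    "W - {} - {p, y} - (\<Union>a\<in>{}. nb a) = W - {p, y}" by auto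
  have c: "card (?S {p} {y}) = F (W - {p, y} - nb p)"
    "card (?S {y} {p}) = F (W - {p, y} - nb y)"
    "card (?S {p, y} {}) = F (W - {p, y} - nb p - nb y)"
    "card (?S {} {p, y}) = F (W - {p, y})"
    using card_stable_sets_constrained[OF fin _ st(1), of "{y}"]
      card_stable_sets_constrained[OF fin _ st(2), of "{p}"]
      card_stable_sets_constrained[OF fin _ st(3), of "{}"]
      card_stable_sets_constrained[OF fin _ st(4), of "{p, y}"] p y \<open>p \<noteq> y\<close>
    unfolding e by simp_all
  define K where "K P = swap_component y ((fst P - snd P) \<union> (snd P - fst P))" for P
  define h where
    "h P = ((fst P - K P) \<union> (snd P \<inter> K P), (snd P - K P) \<union> (fst P \<inter> K P))" for P
  have "inj_on h (?S {p} {y} \<times> ?S {y} {p})"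
  proof (rule inj_onI)
    fix P Q assume PQ: "h P = h Q"
    \<comment> \<open>The symmetric difference survives the swap, so the component, and with it the
      original pair, is recovered from the image.\<close>
    have D: "(fst P - snd P) \<union> (snd P - fst P)
        = (fst (h P) - snd (h P)) \<union> (snd (h P) - fst (h P))" for P
      unfolding h_def by auto
    have KK: "K P = K Q" unfolding K_def using D[of P] D[of Q] PQ by simp
    have "fst P = (fst (h P) - K P) \<union> (snd (h P) \<inter> K P)"
      "snd P = (snd (h P) - K P) \<union> (fst (h P) \<inter> K P)" for P
      unfolding h_def by auto
    then show "P = Q" using PQ KK by (metis prod_eqI)
  qed
  moreover have "h ` (?S {p} {y} \<times> ?S {y} {p}) \<subseteq> ?S {p, y} {} \<times> ?S {} {p, y}"
  proof
    fix Q assume "Q \<in> h ` (?S {p} {y} \<times> ?S {y} {p})"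
    then obtain S S' where Q: "Q = h (S, S')" and S: "S \<in> stable_sets W E" "p \<in> S" "y \<notin> S"
      and S': "S' \<in> stable_sets W E" "y \<in> S'" "p \<notin> S'" by auto
    define D where "D = (S - S') \<union> (S' - S)"
    have yD: "y \<in> D" using S S' D_def by auto
    have K: "K (S, S') = swap_component y D" by (simp add: K_def D_def)
    have "y \<in> K (S, S')" unfolding K swap_component_def by simp
    moreover have "p \<notin> K (S, S')"
      using swap_component_alternates[OF S(1) S'(1) D_def bip, where y = y and v = p] S S' p y K
      by blast
    moreover have "(S - K (S, S')) \<union> (S' \<inter> K (S, S')) \<in> stable_sets W E"
      unfolding K by (rule swap_component_stable[OF S(1) S'(1) D_def yD])
    moreover have "(S' - K (S, S')) \<union> (S \<inter> K (S, S')) \<in> stable_sets W E"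
      unfolding K by (rule swap_component_stable[OF S'(1) S(1) _ yD]) (auto simp: D_def)
    ultimately show "Q \<in> ?S {p, y} {} \<times> ?S {} {p, y}"
      using S S' unfolding Q h_def by auto
  qed
  ultimately have "card (?S {p} {y} \<times> ?S {y} {p}) \<le> card (?S {p, y} {} \<times> ?S {} {p, y})"
    by (rule card_inj_on_le) (use finite_stable_sets[OF fin] in auto)
  then show ?thesis by (simp only: card_cartesian_product c)
qed

end

section \<open>Branches of a tree\<close>

definition induced :: "'a set set \<Rightarrow> 'a set \<Rightarrow> 'a set set" where
  "induced E W = {e \<in> E. e \<subseteq> W}"

lemma adjacent_induced [simp]:
  "adjacent (induced E W) a b \<longleftrightarrow> adjacent E a b \<and> a \<in> W \<and> b \<in> W"
  by (auto simp: adjacent_def induced_def)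

lemma stable_sets_cong:
  assumes "\<And>a b. a \<in> X \<Longrightarrow> b \<in> X \<Longrightarrow> adjacent E a b \<longleftrightarrow> adjacent E' a b"
  shows "stable_sets X E = stable_sets X E'"
  unfolding stable_sets_def using assms by (intro Collect_cong) blast

locale tree_graph =
  fixes V :: "'a set" and E :: "'a set set"
  assumes tree: "tree V E"
begin

lemma simple: "simple_graph V E" and connected: "connected_graph V E" and bridges: "bridges E"
  using tree by (auto simp: tree_iff_bridges)

lemma finite_V: "finite V"
  using simple by (simp add: simple_graph_def)

lemmas adjacent_V = adjacent_simple_graph[OF simple]

end

sublocale tree_graph \<subseteq> loopfree E
  by unfold_locales (use adjacent_V in blast)

context tree_graph
begin

text \<open>Branches are indexed by directed edges, so that no root of the tree is chosen:
  \<open>v\<close> is the root of \<open>br u v\<close>, and \<open>br v u\<close> is the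
  complementary side.\<close>

definition br :: "'a \<Rightarrow> 'a \<Rightarrow> 'a set" where
  "br u v = {w. (adjacent (E - {{u, v}}))\<^sup>*\<^sup>* v w}"

lemma finite_nb: "finite (nb v)"
  by (rule finite_subset[OF _ finite_V]) (auto dest: adjacent_V(2))

lemma br_self: "v \<in> br u v"
  by (simp add: br_def)

lemma br_step: "a \<in> br u v \<Longrightarrow> adjacent E a b \<Longrightarrow> {a, b} \<noteq> {u, v} \<Longrightarrow> b \<in> br u v"
  unfolding br_def mem_Collect_eq
  by (rule rtranclp.rtrancl_into_rtrancl) (auto simp: adjacent_def)

lemma br_notin:
  assumes "adjacent E u v" shows "u \<notin> br u v"
  using bridges assms adjacent_rtranclp_sym[of "E - {{u, v}}" v u]
  unfolding bridges_def br_def by blast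

lemma br_subset:
  assumes "adjacent E u v" shows "br u v \<subseteq> V"
proof
  fix w assume "w \<in> br u v"
  then have "(adjacent (E - {{u, v}}))\<^sup>*\<^sup>* v w" by (simp add: br_def)
  then show "w \<in> V"
  proof (induction rule: rtranclp_induct)
    case (step y z)
    then have "adjacent E y z" by (simp add: adjacent_def)
    then show ?case by (rule adjacent_V)
  qed (use assms adjacent_V in blast)
qed

lemma finite_br: "adjacent E u v \<Longrightarrow> finite (br u v)"
  using br_subset finite_V finite_subset by blast

lemma br_cover:
  assumes uv: "adjacent E u v" shows "br u v \<union> br v u = V"
proof
  show "br u v \<union> br v u \<subseteq> V" using br_subset[OF uv] br_subset[OF adjacent_sym[OF uv]] by simp
  show "V \<subseteq> br u v \<union> br v u"
  proof
    fix w assume "w \<in> V"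
    then have "(adjacent E)\<^sup>*\<^sup>* u w"
      using connected adjacent_V[OF uv] by (auto simp: connected_graph_def)
    then show "w \<in> br u v \<union> br v u"
    proof (induction rule: rtranclp_induct)
      case base
      show ?case using br_self by blast
    next
      case (step a b)
      show ?case
      proof (cases "{a, b} = {u, v}")
        case True
        then have "b = u \<or> b = v" by blast
        then show ?thesis using br_self by blast
      next
        case False
        then have "{a, b} \<noteq> {v, u}" by (simp add: insert_commute)
        then show ?thesis
          using step.IH br_step[OF _ step.hyps(2) False] br_step[OF _ step.hyps(2), of v u] by blast
      qed
    qed
  qed
qed

lemma br_disjoint:
  assumes uv: "adjacent E u v" shows "br u v \<inter> br v u = {}"
proof -
  have "False" if "w \<in> br u v" "w \<in> br v u" for w
  proof -
    have "(adjacent (E - {{u, v}}))\<^sup>*\<^sup>* v w" "(adjacent (E - {{u, v}}))\<^sup>*\<^sup>* u w"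
      using that by (auto simp: br_def insert_commute)
    then have "(adjacent (E - {{u, v}}))\<^sup>*\<^sup>* u v"
      using adjacent_rtranclp_sym rtranclp_trans by metis
    then show False using bridges uv unfolding bridges_def by blast
  qed
  then show ?thesis by blast
qed

lemma br_edge:
  assumes uv: "adjacent E u v" and "a \<in> br u v" "b \<in> br v u"
  shows "adjacent E a b \<longleftrightarrow> a = v \<and> b = u"
proof
  assume ab: "adjacent E a b"
  then have "{a, b} = {u, v}"
    using br_step[OF assms(2) ab] br_disjoint[OF uv] assms by blast
  moreover have "a \<noteq> u" using br_notin[OF uv] assms by blast
  ultimately show "a = v \<and> b = u" by (auto simp: doubleton_eq_iff)
qed (use adjacent_sym[OF uv] in blast)

lemma br_closed:
  assumes "adjacent E u v" "a \<in> br u v" "a \<noteq> v" "adjacent E a b"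
  shows "b \<in> br u v"
proof (rule br_step[OF assms(2,4)])
  have "a \<noteq> u" using br_notin[OF assms(1)] assms(2) by blast
  then show "{a, b} \<noteq> {u, v}" using assms(3) by blast
qed

lemma nb_Int_br:
  assumes uv: "adjacent E u v" shows "nb v \<inter> br u v = nb v - {u}"
proof -
  have "w \<in> br u v" if "adjacent E v w" "w \<noteq> u" for w
  proof (rule br_step[OF br_self that(1)])
    show "{v, w} \<noteq> {u, v}" using that(2) adjacent_V(3)[OF that(1)] by blast
  qed
  then show ?thesis using br_notin[OF uv] by (auto simp: nb_def)
qed

lemma br_child_subset:
  assumes uv: "adjacent E u v" and vw: "adjacent E v w" and "w \<noteq> u"
  shows "br v w \<subseteq> br u v - {v}"
proof
  fix x assume "x \<in> br v w"
  then have "(adjacent (E - {{v, w}}))\<^sup>*\<^sup>* w x" by (simp add: br_def)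
  then have "x \<in> br v w \<and> x \<in> br u v"
  proof (induction rule: rtranclp_induct)
    case base
    have "w \<in> nb v \<inter> br u v" unfolding nb_Int_br[OF uv] using assms by simp
    then show ?case using br_self by simp
  next
    case (step a b)
    then have ab: "adjacent E a b" "{a, b} \<noteq> {v, w}" by (auto simp: adjacent_def)
    then have "b \<in> br v w" using step.IH br_step by blast
    moreover have "a \<noteq> v" using step.IH br_notin[OF vw] by blast
    ultimately show ?case using br_closed[OF uv _ _ ab(1)] step.IH by blast
  qed
  then show "x \<in> br u v - {v}" using br_notin[OF vw] by blast
qed

lemma br_children_disjoint:
  assumes "adjacent E v w" "adjacent E v w'" "w \<noteq> w'"
  shows "br v w \<inter> br v w' = {}"
  using br_child_subset[OF adjacent_sym[OF assms(2)] assms(1,3)]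
    br_disjoint[OF adjacent_sym[OF assms(2)]] by blast

lemma br_Int_nb:
  assumes "adjacent E v w" shows "br v w \<inter> nb v = {w}"
proof -
  have "x = w" if "x \<in> br v w" "adjacent E v x" for x
    using br_children_disjoint[OF assms that(2)] br_self[of x v] that(1) by blast
  then show ?thesis using br_self assms by (auto simp: nb_def)
qed

lemma br_separated:
  assumes vw: "adjacent E v w" shows "separated (br v w) (W - {v} - br v w)"
proof -
  have "\<not> adjacent E a b" if "a \<in> br v w" "b \<notin> br v w" "b \<noteq> v" for a b
    using br_step[OF that(1), of b] that br_notin[OF vw] by (auto simp: doubleton_eq_iff)
  then show ?thesis by (auto simp: separated_def)
qed

lemma br_decomp:
  assumes "x \<in> br u v" "x \<noteq> v"
  obtains w where "adjacent E v w" "w \<noteq> u" "x \<in> br v w"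
proof -
  have "(adjacent (E - {{u, v}}))\<^sup>*\<^sup>* v x" using assms by (simp add: br_def)
  then have "x \<noteq> v \<longrightarrow> (\<exists>w. adjacent E v w \<and> w \<noteq> u \<and> x \<in> br v w)"
  proof (induction rule: rtranclp_induct)
    case (step a b)
    then have ab: "adjacent E a b" "{a, b} \<noteq> {u, v}" by (auto simp: adjacent_def)
    show ?case
    proof (cases "a = v")
      case True
      then show ?thesis using ab br_self by blast
    next
      case False
      then obtain w where w: "adjacent E v w" "w \<noteq> u" "a \<in> br v w" using step.IH by blast
      have "b \<noteq> v \<Longrightarrow> b \<in> br v w" using br_step[OF w(3) ab(1)] False
        by (auto simp: doubleton_eq_iff)
      then show ?thesis using w by blast
    qed
  qed simp
  then show ?thesis using assms that by blast
qed

lemma V_decomp: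
  assumes "x \<in> V" "v \<in> V" "x \<noteq> v"
  obtains w where "adjacent E v w" "x \<in> br v w"
proof -
  have "(adjacent E)\<^sup>*\<^sup>* v x" using assms connected by (simp add: connected_graph_def)
  then have "\<exists>w. adjacent E v w" using assms(3) by (metis converse_rtranclpE)
  then obtain w where w: "adjacent E v w" by blast
  show ?thesis
  proof (cases "x \<in> br v w")
    case True
    then show ?thesis using that w by blast
  next
    case False
    then have "x \<in> br w v" using br_cover[OF w] assms by blast
    then show ?thesis using br_decomp that assms(3) by metis
  qed
qed

section \<open>Core status along directed edges\<close>

definition cr :: "'a \<Rightarrow> 'a \<Rightarrow> bool" where "cr u v \<longleftrightarrow> core (br u v) v"

lemma cr_iff:
  assumes uv: "adjacent E u v"
  shows "cr u v \<longleftrightarrow> (\<forall>w. adjacent E v w \<longrightarrow> w \<noteq> u \<longrightarrow> \<not> cr v w)"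
proof -
  have "core (br u v) v \<longleftrightarrow> (\<forall>w\<in>nb v \<inter> br u v. \<not> core (br v w) w)"
  proof (rule core_iff_branches)
    fix w assume "w \<in> nb v \<inter> br u v"
    then have "adjacent E v w" "w \<noteq> u" unfolding nb_Int_br[OF uv] by auto
    then show "w \<in> br v w \<and> br v w \<subseteq> br u v - {v} \<and> br v w \<inter> nb v = {w}
        \<and> separated (br v w) (br u v - {v} - br v w)"
      using br_self br_child_subset[OF uv] br_Int_nb br_separated by blast
  qed (use br_self finite_br[OF uv] in auto)
  then show ?thesis unfolding nb_Int_br[OF uv] cr_def by auto
qed

lemma core_V_iff:
  assumes v: "v \<in> V"
  shows "core V v \<longleftrightarrow> (\<forall>w. adjacent E v w \<longrightarrow> \<not> cr v w)"
proof -
  have "core V v \<longleftrightarrow> (\<forall>w\<in>nb v \<inter> V. \<not> core (br v w) w)"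
  proof (rule core_iff_branches)
    fix w assume "w \<in> nb v \<inter> V"
    then have "adjacent E v w" by auto
    then show "w \<in> br v w \<and> br v w \<subseteq> V - {v} \<and> br v w \<inter> nb v = {w}
        \<and> separated (br v w) (V - {v} - br v w)"
      using br_self br_subset br_notin br_Int_nb br_separated by blast
  qed (use v finite_V in auto)
  then show ?thesis unfolding cr_def using adjacent_V by auto
qed

lemma br_child_card:
  assumes "adjacent E u v" "adjacent E v w" "w \<noteq> u"
  shows "card (br v w) < card (br u v)"
  by (rule psubset_card_mono) (use finite_br[OF assms(1)] br_child_subset[OF assms] br_self[of v u] in auto)

lemma leaf_in_br:
  assumes "adjacent E u v"
  obtains l p where "l \<in> br u v" "nb l = {p}"
proof -
  have "\<exists>l p. l \<in> br u v \<and> nb l = {p}" using assms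
  proof (induction "card (br u v)" arbitrary: u v rule: less_induct)
    case less
    show ?case
    proof (cases "nb v = {u}")
      case True
      then show ?thesis using br_self by blast
    next
      case False
      then obtain w where w: "adjacent E v w" "w \<noteq> u" using adjacent_sym[OF less.prems] mem_nb by blast
      then obtain l p where "l \<in> br v w" "nb l = {p}"
        using less.hyps[OF br_child_card[OF less.prems w] w(1)] by blast
      then show ?thesis using br_child_subset[OF less.prems w] by blast
    qed
  qed
  then show ?thesis using that by blast
qed

text \<open>Core vertices recur two edges further on: as \<open>cr u v\<close> fails,
  \<open>v\<close> has a child \<open>w\<close> with \<open>cr v w\<close>, and
  \<open>cr v u\<close> blocks \<open>cr w v\<close>, so \<open>w\<close> is core in the whole tree.
  The descent can only end at a leaf reached as such a \<open>w\<close>.\<close>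

lemma core_leaf_in_br:
  assumes "adjacent E u v" "core V u"
  obtains l p where "l \<in> br u v" "nb l = {p}" "core V l"
proof -
  have "\<exists>l p. l \<in> br u v \<and> nb l = {p} \<and> core V l" using assms
  proof (induction "card (br u v)" arbitrary: u v rule: less_induct)
    case less
    have uV: "u \<in> V" using less.prems adjacent_V by blast
    have "\<not> cr u v" using less.prems core_V_iff[OF uV] by blast
    then obtain w where w: "adjacent E v w" "w \<noteq> u" "cr v w" using cr_iff[OF less.prems(1)] by blast
    have wV: "w \<in> V" using w adjacent_V by blast
    have vu: "adjacent E v u" and wv: "adjacent E w v"
      using adjacent_sym[OF less.prems(1)] adjacent_sym[OF w(1)] .
    have "cr v u" using cr_iff[OF vu] less.prems core_V_iff[OF uV] by blast
    then have "\<not> cr w v" using cr_iff[OF wv] vu w by blast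
    then have core: "core V w" using core_V_iff[OF wV] w cr_iff[OF w(1)] by blast
    show ?case
    proof (cases "nb w = {v}")
      case True
      then show ?thesis using core br_child_subset[OF less.prems(1) w(1,2)] br_self by blast
    next
      case False
      then obtain x where x: "adjacent E w x" "x \<noteq> v" using wv mem_nb by blast
      have "card (br w x) < card (br u v)"
        using br_child_card[OF w(1) x] br_child_card[OF less.prems(1) w(1,2)] by linarith
      then obtain l p where "l \<in> br w x" "nb l = {p}" "core V l"
        using less.hyps[OF _ x(1) core] by blast
      then show ?thesis
        using br_child_subset[OF less.prems(1) w(1,2)] br_child_subset[OF w(1) x] by blast
    qed
  qed
  then show ?thesis using that by blast
qed

lemma tree_br:
  assumes uv: "adjacent E u v"
  shows "tree (br u v) (induced E (br u v))"
proof -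
  let ?E = "induced E (br u v)"
  have "simple_graph (br u v) ?E"
    using simple finite_br[OF uv] by (auto simp: simple_graph_def induced_def)
  moreover have "bridges ?E" by (rule bridges_mono[OF bridges]) (auto simp: induced_def)
  moreover have "connected_graph (br u v) ?E"
  proof -
    have "(adjacent ?E)\<^sup>*\<^sup>* v w" if "w \<in> br u v" for w
    proof -
      have "(adjacent (E - {{u, v}}))\<^sup>*\<^sup>* v w" using that by (simp add: br_def)
      then have "w \<in> br u v \<and> (adjacent ?E)\<^sup>*\<^sup>* v w"
      proof (induction rule: rtranclp_induct)
        case base
        show ?case using br_self by simp
      next
        case (step a b)
        then have ab: "adjacent E a b" "{a, b} \<noteq> {u, v}" by (auto simp: adjacent_def)
        then have "b \<in> br u v" using step.IH br_step by blast
        moreover have "adjacent ?E a b" using calculation step.IH ab by simp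
        ultimately show ?case using step.IH by (auto intro: rtranclp.rtrancl_into_rtrancl)
      qed
      then show ?thesis ..
    qed
    then have "(adjacent ?E)\<^sup>*\<^sup>* w w'" if "w \<in> br u v" "w' \<in> br u v" for w w'
      using that by (meson adjacent_rtranclp_sym rtranclp_trans)
    then show ?thesis using br_self[of v u] by (auto simp: connected_graph_def)
  qed
  ultimately show ?thesis by (simp add: tree_iff_bridges)
qed

lemma E_split:
  assumes uv: "adjacent E u v"
  shows "E = insert {u, v} (induced E (br u v) \<union> induced E (br v u))"
proof
  show "insert {u, v} (induced E (br u v) \<union> induced E (br v u)) \<subseteq> E"
    using uv by (auto simp: adjacent_def induced_def)
  show "E \<subseteq> insert {u, v} (induced E (br u v) \<union> induced E (br v u))"
  proof
    fix e assume e: "e \<in> E"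
    then have "card e = 2" using simple by (auto simp: simple_graph_def)
    then obtain a b where ab: "e = {a, b}" by (auto simp: card_2_iff)
    then have adj: "adjacent E a b" using e by (simp add: adjacent_def)
    then have "a \<in> br u v \<union> br v u" using br_cover[OF uv] adjacent_V by blast
    then show "e \<in> insert {u, v} (induced E (br u v) \<union> induced E (br v u))"
      using br_step[of a u v b] br_step[of a v u b] adj ab e
      by (auto simp: induced_def insert_commute)
  qed
qed

lemma core_leaf:
  assumes "v \<in> V" "core V v"
  obtains l p where "l \<in> V" "core V l" "nb l \<subseteq> {p}"
proof (cases "nb v = {}")
  case True
  then show ?thesis using that[of v v] assms by simp
next
  case False
  then obtain w where "adjacent E v w" by auto
  then show ?thesis using core_leaf_in_br[OF _ assms(2)] br_subset that by (metis subset_iff subset_refl)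
qed

end

section \<open>Moving a branch of an extremal tree\<close>

locale extremal_graph = tree_graph +
  assumes extremal: "extremal_tree V E"
begin

text \<open>The number of stable sets of \<open>W\<close> that contain \<open>v\<close>, for \<open>v \<in> W\<close>.\<close>

abbreviation ins :: "'a set \<Rightarrow> 'a \<Rightarrow> nat" where
  "ins W v \<equiv> F (W - {v} - nb v)"

text \<open>Replacing the edge \<open>uv\<close> by \<open>u'v\<close> changes the number of stable sets from
  \<open>F U * F W - ins U u * ins W v\<close> to \<open>F U * F W - ins U u' * ins W v\<close>.\<close>

lemma move:
  assumes uv: "adjacent E u v" and u': "u' \<in> br v u"
    and cr: "cr u v \<Longrightarrow> core (br v u) u' \<longleftrightarrow> cr v u"
  shows "ins (br v u) u' \<le> ins (br v u) u"
proof -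
  define U where "U = br v u"
  define W where "W = br u v"
  have vu: "adjacent E v u" by (rule adjacent_sym[OF uv])
  have fin: "finite U" "finite W" using finite_br[OF uv] finite_br[OF vu] by (auto simp: U_def W_def)
  have dj: "U \<inter> W = {}" using br_disjoint[OF vu] by (simp add: U_def W_def)
  have mem: "u \<in> U" "u' \<in> U" "v \<in> W" using br_self u' by (auto simp: U_def W_def)
  have V: "U \<union> W = V" using br_cover[OF vu] by (simp add: U_def W_def)
  define E' where "E' = insert {u', v} (induced E U \<union> induced E W)"
  have tree': "tree V E'"
    using tree_join[OF tree_br[OF vu] tree_br[OF uv], of u' v] dj mem V
    unfolding E'_def U_def W_def by simp
  interpret T: tree_graph V E' by unfold_locales (rule tree')
  have ind: "adjacent E' a b \<longleftrightarrow> {a, b} = {u', v} \<or> adjacent E a b \<and> (a \<in> U \<and> b \<in> U \<or> a \<in> W \<and> b \<in> W)"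
    for a b by (auto simp: E'_def adjacent_def induced_def)
  have out: "v \<notin> U" "u' \<notin> W" "u \<notin> W" using dj mem by auto
  have inU: "adjacent E' a b \<longleftrightarrow> adjacent E a b" if "a \<in> U" "b \<in> U" for a b
  proof -
    have "{a, b} \<noteq> {u', v}" using that out(1) by (auto simp: doubleton_eq_iff)
    then show ?thesis using that by (simp add: ind)
  qed
  have inW: "adjacent E' a b \<longleftrightarrow> adjacent E a b" if "a \<in> W" "b \<in> W" for a b
  proof -
    have "{a, b} \<noteq> {u', v}" using that out(2) by (auto simp: doubleton_eq_iff)
    then show ?thesis using that by (simp add: ind)
  qed
  have sU: "stable_sets X E' = stable_sets X E" if "X \<subseteq> U" for X
    by (rule stable_sets_cong, rule inU) (use that in auto)
  have sW: "stable_sets X E' = stable_sets X E" if "X \<subseteq> W" for X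
    by (rule stable_sets_cong, rule inW) (use that in auto)
  have nU: "U - {u'} - T.nb u' = U - {u'} - nb u'" using inU[OF mem(2)] by (auto simp: T.nb_def nb_def)
  have nW: "W - {v} - T.nb v = W - {v} - nb v" using inW[OF mem(3)] by (auto simp: T.nb_def nb_def)
  have FU: "T.F X = F X" "T.al X = al X" if "X \<subseteq> U" for X
    using sU[OF that] by (auto simp: num_stable_sets_def stability_number_def)
  have FW: "T.F X = F X" "T.al X = al X" if "X \<subseteq> W" for X
    using sW[OF that] by (auto simp: num_stable_sets_def stability_number_def)
  have cU: "T.core U u' \<longleftrightarrow> core U u'" unfolding T.core_def core_def
    using FU(2)[of U] FU(2)[of "U - {u'}"] by auto
  have cW: "T.core W v \<longleftrightarrow> core W v" unfolding T.core_def core_def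
    using FW(2)[of W] FW(2)[of "W - {v}"] by auto
  have e: "adjacent E a b \<longleftrightarrow> a = u \<and> b = v" if "a \<in> U" "b \<in> W" for a b
    using br_edge[OF vu] that unfolding U_def W_def by blast
  have e': "adjacent E' a b \<longleftrightarrow> a = u' \<and> b = v" if "a \<in> U" "b \<in> W" for a b
  proof -
    have "a \<notin> W" "b \<notin> U" using that dj by auto
    moreover have "{a, b} = {u', v} \<longleftrightarrow> a = u' \<and> b = v"
      using that out by (auto simp: doubleton_eq_iff)
    ultimately show ?thesis by (simp add: ind)
  qed
  \<comment> \<open>By \<open>al_join\<close> the edge costs one only if both ends are core. The
    hypothesis \<open>cr\<close> makes \<open>u'\<close> agree with \<open>u\<close> in this
    respect, and demands nothing when \<open>v\<close> is not core on its side.\<close>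
  have "al V = T.al V"
  proof -
    have "al V + (if core U u \<and> core W v then 1 else 0) = al U + al W"
      using al_join[OF fin dj mem(1,3) e] V by simp
    moreover have "T.al V + (if core U u' \<and> core W v then 1 else 0) = al U + al W"
      using T.al_join[OF fin dj mem(2,3) e'] V FU(2)[of U] FW(2)[of W] cU cW by simp
    moreover have "core W v \<Longrightarrow> core U u' \<longleftrightarrow> core U u"
      using cr unfolding cr_def U_def W_def by blast
    ultimately show ?thesis by (auto split: if_splits)
  qed
  then have "F V \<le> T.F V" using extremal tree' unfolding extremal_tree_def by metis
  moreover have "F V + ins U u * ins W v = F U * F W"
    using F_join[OF fin dj mem(1,3) e] V by simp
  moreover have "T.F V + ins U u' * ins W v = F U * F W"
  proof -
    have i: "T.F (U - {u'} - nb u') = ins U u'" "T.F (W - {v} - nb v) = ins W v"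
      by (rule FU(1), blast) (rule FW(1), blast)
    show ?thesis
      using T.F_join[OF fin dj mem(2,3) e'] V FU(1)[of U] FW(1)[of W] unfolding nU nW i by simp
  qed
  ultimately have "ins U u' * ins W v \<le> ins U u * ins W v" by linarith
  moreover have "0 < ins W v" using fin by (intro F_pos) auto
  ultimately show ?thesis unfolding U_def by simp
qed

text \<open>At least a third of the stable sets of the branch \<open>br u v\<close> contain \<open>v\<close>.\<close>

definition heavy :: "'a \<Rightarrow> 'a \<Rightarrow> bool" where
  "heavy u v \<longleftrightarrow> F (br u v - {v}) \<le> 2 * ins (br u v) v"

lemma heavy_if_leaf_le:
  assumes uv: "adjacent E u v" and l: "l \<in> br u v" "nb l \<inter> br u v \<subseteq> {p}"
    and le: "ins (br u v) l \<le> ins (br u v) v"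
  shows "heavy u v"
  using F_rec[OF finite_br[OF uv] br_self] F_rec[OF finite_br[OF uv] l(1)]
    leaf_in_third[OF finite_br[OF uv] l] le unfolding heavy_def by linarith

text \<open>When \<open>u\<close> is not core on its own side, that side may be attached anywhere in
  \<open>br u v\<close> without changing the stability number, so a leaf of \<open>br u v\<close> is
  an admissible rival of \<open>v\<close>.\<close>

lemma heavy_if_not_cr:
  assumes uv: "adjacent E u v" and "\<not> cr v u"
  shows "heavy u v"
proof -
  obtain l p where l: "l \<in> br u v" "nb l = {p}" using leaf_in_br[OF uv] .
  have "ins (br u v) l \<le> ins (br u v) v"
    by (rule move[OF adjacent_sym[OF uv] l(1)]) (use assms(2) in blast)
  then show ?thesis using heavy_if_leaf_le[OF uv l(1), of p] l(2) by blast
qed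

text \<open>Both ends are forced here, so only core vertices of the branch may replace
  \<open>v\<close>. The rival is a core leaf of the branch, regarded as a tree of its own.\<close>

lemma heavy_if_cr_cr:
  assumes uv: "adjacent E u v" and cr: "cr u v" "cr v u"
  shows "heavy u v"
proof -
  let ?B = "br u v"
  interpret B: tree_graph ?B "induced E ?B" by unfold_locales (rule tree_br[OF uv])
  have s: "stable_sets X (induced E ?B) = stable_sets X E" if "X \<subseteq> ?B" for X
    by (rule stable_sets_cong) (use that in auto)
  have al: "B.al X = al X" if "X \<subseteq> ?B" for X
    using s[OF that] by (simp add: stability_number_def)
  have core: "B.core ?B x \<longleftrightarrow> core ?B x" for x
    unfolding B.core_def core_def using al[of ?B] al[of "?B - {x}"] by auto
  obtain l p where l: "l \<in> ?B" "B.core ?B l" "B.nb l \<subseteq> {p}"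
    using B.core_leaf[OF br_self] cr(1) core unfolding cr_def by blast
  have "ins ?B l \<le> ins ?B v"
    by (rule move[OF adjacent_sym[OF uv] l(1)]) (use l(2) core cr in blast)
  moreover have "nb l \<inter> ?B \<subseteq> {p}" using l(1,3) by (auto simp: B.nb_def nb_def)
  ultimately show ?thesis using heavy_if_leaf_le[OF uv l(1)] by blast
qed

lemma heavy_two_children:
  assumes uv: "adjacent E u v" "heavy u v" and w: "adjacent E v w" "w \<noteq> u" "heavy v w"
    and w': "adjacent E v w'" "w' \<noteq> u" "heavy v w'" and "w \<noteq> w'"
  shows False
proof -
  define W where "W = br u v"
  define B where "B = br v w"
  define B' where "B' = br v w'"
  define R where "R = W - {v} - B - B'"
  have fW: "finite W" using finite_br[OF uv(1)] by (simp add: W_def)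
  have sub: "B \<subseteq> W - {v}" "B' \<subseteq> W - {v}"
    using br_child_subset[OF uv(1) w(1,2)] br_child_subset[OF uv(1) w'(1,2)]
    by (auto simp: W_def B_def B'_def)
  have fin: "finite B" "finite B'" "finite R" using fW sub by (auto simp: R_def intro: finite_subset)
  have dj: "B \<inter> B' = {}" using br_children_disjoint w(1) w'(1) \<open>w \<noteq> w'\<close> by (auto simp: B_def B'_def)
  have nb: "B \<inter> nb v = {w}" "B' \<inter> nb v = {w'}" using br_Int_nb w(1) w'(1) by (auto simp: B_def B'_def)
  have sep: "separated B (B' \<union> R)" "separated B' R"
    using separated_subset[OF br_separated[OF w(1), of W], of B "B' \<union> R"]
      separated_subset[OF br_separated[OF w'(1), of W], of B' R] sub dj
    by (auto simp: B_def B'_def R_def)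
  have e1: "W - {v} = B \<union> (B' \<union> R)" using sub by (auto simp: R_def)
  have e2: "W - {v} - nb v = (B - {w}) \<union> ((B' - {w'}) \<union> (R - nb v))"
    using e1 nb by blast
  have F1: "F (W - {v}) = F B * (F B' * F R)" using e1 F_Un sep by simp
  have F2: "ins W v = F (B - {w}) * (F (B' - {w'}) * F (R - nb v))"
  proof -
    have "separated (B - {w}) ((B' - {w'}) \<union> (R - nb v))"
      by (rule separated_subset[OF sep(1)]) auto
    moreover have "separated (B' - {w'}) (R - nb v)"
      by (rule separated_subset[OF sep(2)]) auto
    ultimately show ?thesis unfolding e2 by (simp add: F_Un)
  qed
  have h: "3 * F (B - {w}) \<le> 2 * F B" "3 * F (B' - {w'}) \<le> 2 * F B'"
    using w(3) w'(3) F_rec[OF fin(1), of w] F_rec[OF fin(2), of w'] br_self[of w v] br_self[of w' v]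
    unfolding heavy_def B_def B'_def by linarith+
  \<comment> \<open>Two heavy children leave at most \<open>(2/3)^2 = 4/9\<close> of the sets
    avoiding \<open>v\<close> when \<open>v\<close> is put in, but \<open>heavy u v\<close> asks for
    at least \<open>1/2\<close>.\<close>
  have "9 * ins W v = (3 * F (B - {w})) * ((3 * F (B' - {w'})) * F (R - nb v))" unfolding F2 by simp
  also have "\<dots> \<le> (2 * F B) * ((2 * F B') * F R)"
    by (intro mult_le_mono h F_mono[OF fin(3)]) auto
  also have "\<dots> = 4 * F (W - {v})" unfolding F1 by simp
  also have "\<dots> \<le> 8 * ins W v" using uv(2) unfolding heavy_def W_def by simp
  finally have "ins W v = 0" by simp
  moreover have "0 < ins W v" using fW by (intro F_pos) auto
  ultimately show False by simp
qed

section \<open>Edges that are not oriented\<close>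

text \<open>As \<open>v\<close> is heavy from \<open>u\<close>, at most one child of
  \<open>v\<close> can be heavy. Some child \<open>w\<close> is core in its branch; two such
  children, or one of them together with any other child, would both be heavy.\<close>

lemma neither_cr_nb:
  assumes uv: "adjacent E u v" and n: "\<not> cr u v" "\<not> cr v u"
  obtains w where "nb v = {u, w}" "w \<noteq> u" "cr v w" "cr w v"
proof -
  have vu: "adjacent E v u" by (rule adjacent_sym[OF uv])
  obtain w where w: "adjacent E v w" "w \<noteq> u" "cr v w" using n(1) cr_iff[OF uv] by blast
  have h: "heavy u v" by (rule heavy_if_not_cr[OF uv n(2)])
  have wv: "adjacent E w v" by (rule adjacent_sym[OF w(1)])
  have not_cr: "\<not> cr v c" if c: "adjacent E v c" "c \<noteq> u" "c \<noteq> w" for c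
  proof
    assume "cr v c"
    then have "\<not> cr w v" "\<not> cr c v"
      using c w cr_iff[OF wv] cr_iff[OF adjacent_sym[OF c(1)]] by blast+
    then show False
      using heavy_two_children[OF uv h w(1,2) _ c(1,2)] heavy_if_not_cr w(1) c by metis
  qed
  have wcr: "cr w v" unfolding cr_iff[OF wv] using not_cr n(2) by blast
  have "c = u \<or> c = w" if c: "adjacent E v c" for c
  proof (rule ccontr)
    assume *: "\<not> (c = u \<or> c = w)"
    have "\<not> cr c v" using w * cr_iff[OF adjacent_sym[OF c]] by blast
    then have "heavy v c" by (rule heavy_if_not_cr[OF c])
    then show False
      using heavy_two_children[OF uv h w(1,2) heavy_if_cr_cr[OF w(1,3) wcr] c] * by blast
  qed
  then have "nb v = {u, w}" using vu w(1) by (auto simp: nb_def)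
  then show ?thesis using that w wcr by blast
qed

text \<open>An edge with both ends core acts as the matching edge at \<open>v\<close>:
  \<open>cr w v\<close> rules out core children other than \<open>w\<close>, and
  \<open>cr v w\<close> makes \<open>w\<close> an obstruction to every other
  \<open>cr c v\<close>.\<close>

lemma critical_other:
  assumes "adjacent E v w" "cr v w" "cr w v" "adjacent E v c" "c \<noteq> w"
  shows "\<not> cr v c" "\<not> cr c v"
  using assms cr_iff[OF adjacent_sym[OF assms(1)]] cr_iff[OF adjacent_sym[OF assms(4)]] by blast+

lemma unoriented_mate:
  assumes "adjacent E v u" "cr v u \<longleftrightarrow> cr u v"
  obtains w where "adjacent E v w" "cr v w" "cr w v" "card (nb v) \<le> 2"
proof (cases "cr v u")
  case True
  note u = assms(1) True True[unfolded assms(2)]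
  have "card (nb v) \<le> 2"
  proof (cases "nb v = {u}")
    case False
    then obtain c where c: "adjacent E v c" "c \<noteq> u" using u(1) mem_nb by blast
    then obtain w where "nb v = {c, w}"
      using neither_cr_nb[OF adjacent_sym[OF c(1)]] critical_other[OF u c] by metis
    then show ?thesis by (simp add: card_insert_if)
  qed simp
  then show ?thesis using that u by blast
next
  case False
  then obtain w where w: "nb v = {u, w}" "w \<noteq> u" "cr v w" "cr w v"
    using neither_cr_nb[OF adjacent_sym[OF assms(1)]] assms(2) by metis
  then have "adjacent E v w" using mem_nb by blast
  then show ?thesis using that w by (simp add: card_insert_if)
qed

text \<open>Once a vertex has a mate, every edge at it has both ends core or neither, so being
  unoriented spreads along walks to the whole tree.\<close>

lemma unoriented_all:
  assumes "adjacent E a b" "cr a b \<longleftrightarrow> cr b a" and "v \<in> V"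
  obtains w where "adjacent E v w" "cr v w" "cr w v" "card (nb v) \<le> 2"
proof -
  have "(adjacent E)\<^sup>*\<^sup>* a v"
    using connected assms(3) adjacent_V[OF assms(1)] by (simp add: connected_graph_def)
  then have "\<exists>u. adjacent E v u \<and> (cr v u \<longleftrightarrow> cr u v)"
  proof (induction rule: rtranclp_induct)
    case (step x y)
    then obtain u where "adjacent E x u" "cr x u \<longleftrightarrow> cr u x" by blast
    then obtain w where w: "adjacent E x w" "cr x w" "cr w x" using unoriented_mate by metis
    then have "cr x y \<longleftrightarrow> cr y x" using critical_other[OF w step.hyps(2)] by blast
    then show ?case using adjacent_sym[OF step.hyps(2)] by blast
  qed (use assms in blast)
  then show ?thesis using unoriented_mate that by metis
qed

end

text \<open>In the notation of \<open>core_degree_le_2\<close>: \<open>k = a10 / a00\<close>,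
  \<open>b = a01 / a00\<close>, \<open>1 + R = m / m0\<close>, while \<open>r\<close> and
  \<open>t\<close> are the odds of \<open>y3\<close> and \<open>z\<close> in their branches. The
  three moves supply \<open>lower\<close>, \<open>upper\<close> and the bound on
  \<open>t\<close>.\<close>

lemma branching_ratio_contradiction:
  fixes k b R r t :: real
  assumes k: "0 < k" "k \<le> r" and r: "r \<le> R" and t: "t * (1 + R) \<le> 1"
    and lower: "(1 + R) * (1 + k) \<le> 1 + b"
    and upper: "b * ((1 + R) * (1 + r) + 1) \<le> 2 * k * (1 + t) * ((1 + R) * (1 + r))"
  shows False
proof -
  have pos: "0 < r" "0 < R" using assms by auto
  have b: "k + R + k * R \<le> b" using lower by (simp add: algebra_simps)
  then have "0 \<le> b" using k pos mult_pos_pos[of k R] by linarith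
  then have "(k + R + k * R) * (2 + R + r + R * r) \<le> b * ((1 + R) * (1 + r) + 1)"
    using b pos by (intro mult_mono) (auto simp: algebra_simps)
  also note upper
  \<comment> \<open>This grouping eliminates \<open>t\<close>: its bound says
    \<open>(1 + t) * (1 + R) \<le> 2 + R\<close>.\<close>
  also have "2 * k * (1 + t) * ((1 + R) * (1 + r)) = (2 * k * (1 + r)) * ((1 + t) * (1 + R))"
    by (simp add: algebra_simps)
  also have "\<dots> \<le> (2 * k * (1 + r)) * (2 + R)"
    using t pos k by (intro mult_left_mono) (auto simp: algebra_simps)
  finally have main: "(k + R + k * R) * (2 + R + r + R * r) \<le> (2 * k * (1 + r)) * (2 + R)" .
  define c where "c = R - 2 - 3 * r + R\<^sup>2 + R\<^sup>2 * r"
  have f: "k * c + R * (2 + R + r + R * r) \<le> 0"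
    using main unfolding c_def by (simp add: algebra_simps power2_eq_square)
  have R1: "0 < R * (2 + R + r + R * r)" using pos by (intro mult_pos_pos) (auto intro: add_pos_pos)
  show False
  proof (cases "0 \<le> c")
    case True
    then have "0 \<le> k * c" using k by simp
    then show False using f R1 by linarith
  next
    case False
    \<comment> \<open>The left side of \<open>f\<close> is linear in \<open>k\<close> with negative
      slope, so putting the largest value \<open>r\<close> for \<open>k\<close> only lowers
      it.\<close>
    then have "r * c \<le> k * c" using k by (intro mult_right_mono_neg) auto
    then have "r * c + R * (2 + R + r + R * r) \<le> 0" using f by linarith
    \<comment> \<open>For \<open>r = R\<close> only the cubic and quartic terms survive, which shows
      how close the two bounds are.\<close>
    moreover have "r * c + R * (2 + R + r + R * r)
        = 2 * (R - r) + (R * R - r * r) + 2 * (r * (R - r)) + 2 * (R * R * r) + (R * r) * (R * r)"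
      unfolding c_def by (simp add: algebra_simps power2_eq_square)
    moreover have "0 < 2 * (R - r) + (R * R - r * r) + 2 * (r * (R - r)) + 2 * (R * R * r)
        + (R * r) * (R * r)"
    proof -
      have "r * r \<le> R * R" using r pos by (intro mult_mono) auto
      moreover have "0 \<le> r * (R - r)" "0 < R * R * r" "0 \<le> (R * r) * (R * r)" using r pos by auto
      ultimately show ?thesis
        using r by (intro add_pos_nonneg[OF add_nonneg_pos] add_nonneg_nonneg) auto
    qed
    ultimately show False by linarith
  qed
qed

text \<open>Dictionary for \<open>core_degree_le_2\<close>: \<open>ax\<close>, \<open>ap\<close>,
  \<open>ay\<close>, \<open>ab\<close> are \<open>a00\<close>, \<open>a01\<close>,
  \<open>a10\<close>, \<open>a11\<close>; \<open>cp\<close>, \<open>cy\<close> are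
  \<open>c01\<close>, \<open>c10\<close>; \<open>mx\<close> is \<open>m0\<close>; \<open>i\<close>,
  \<open>e\<close> count the stable sets of \<open>Y3\<close> with and without \<open>y3\<close>,
  and \<open>zi\<close>, \<open>zo\<close> those of \<open>Z\<close> with and without
  \<open>z\<close>.\<close>

lemma branching_count_contradiction:
  fixes ax ap ay ab cp cy m mx i e zi zo :: real
  assumes pos: "0 < ax" "0 < cy" "0 < m" "0 < mx" "0 < e" "0 < zo" "0 \<le> i" "0 \<le> zi" "0 \<le> cp"
    and A: "m * (ax + ay) + mx * ax \<le> mx * (2 * ax + ap)"
    and T: "zi * m \<le> mx * zo"
    and C: "cp * (m * (i + e) + mx * e) \<le> 2 * cy * (m * (i + e))"
    and a: "ap = (zi + zo) * cp" "ay = zo * cy"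
    and corr: "ap * ay \<le> ab * ax"
    and min: "(2 * ay + ab) * e \<le> i * (2 * ax + ap)"
    and le: "mx * (i + e) \<le> m * e"
  shows False
proof -
  define k where "k = ay / ax"
  define b where "b = ap / ax"
  define R where "R = m / mx - 1"
  define r where "r = i / e"
  define t where "t = zi / zo"
  have eqs: "ay = k * ax" "ap = b * ax" "m = (1 + R) * mx" "i = r * e" "zi = t * zo"
    using pos by (auto simp: k_def b_def R_def r_def t_def)
  have "0 < ay" using a pos by simp
  then have k0: "0 < k" using pos by (simp add: k_def)
  have s: "0 < 2 * ax + ap" using pos a by (simp add: add_pos_nonneg)
  \<comment> \<open>By \<open>corr\<close> the odds \<open>(2 * ay + ab) / (2 * ax + ap)\<close> of
    \<open>y1\<close> are at least \<open>ay / ax\<close>, and \<open>min\<close> bounds them by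
    \<open>r\<close>; hence \<open>k \<le> r\<close>.\<close>
  have "ay * (2 * ax + ap) \<le> ax * (2 * ay + ab)" using corr by (simp add: algebra_simps)
  then have "ay * (2 * ax + ap) * e \<le> ax * (2 * ay + ab) * e"
    using pos by (intro mult_right_mono) auto
  also have "\<dots> = ax * ((2 * ay + ab) * e)" by simp
  also have "\<dots> \<le> ax * (i * (2 * ax + ap))" using min pos by (intro mult_left_mono) auto
  finally have "(ay * e) * (2 * ax + ap) \<le> (ax * i) * (2 * ax + ap)" by (simp add: algebra_simps)
  then have "ay * e \<le> ax * i" using s by (simp only: mult_le_cancel_right_pos)
  then have kr: "k \<le> r" using pos by (simp add: k_def r_def field_simps)
  have rR: "r \<le> R"
  proof -
    have "(mx * e) * (1 + r) \<le> (mx * e) * (1 + R)" using le unfolding eqs by (simp add: algebra_simps)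
    then show ?thesis using pos by (simp add: mult_le_cancel_left_pos)
  qed
  have t: "t * (1 + R) \<le> 1"
  proof -
    have "(mx * zo) * (t * (1 + R)) \<le> (mx * zo) * 1" using T unfolding eqs by (simp add: algebra_simps)
    then show ?thesis using pos by (simp only: mult_le_cancel_left_pos mult_pos_pos)
  qed
  have lower: "(1 + R) * (1 + k) \<le> 1 + b"
  proof -
    have "(mx * ax) * ((1 + R) * (1 + k)) \<le> (mx * ax) * (1 + b)"
      using A unfolding eqs by (simp add: algebra_simps)
    then show ?thesis using pos by (simp only: mult_le_cancel_left_pos mult_pos_pos)
  qed
  have upper: "b * ((1 + R) * (1 + r) + 1) \<le> 2 * k * (1 + t) * ((1 + R) * (1 + r))"
  proof -
    have "((zi + zo) * cp) * (m * (i + e) + mx * e) = (zi + zo) * (cp * (m * (i + e) + mx * e))"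
      by simp
    also have "\<dots> \<le> (zi + zo) * (2 * cy * (m * (i + e)))"
      using C pos by (intro mult_left_mono) auto
    also have "\<dots> = 2 * (1 + t) * (zo * cy) * (m * (i + e))" unfolding eqs by (simp add: algebra_simps)
    finally have "(b * ax) * (m * (i + e) + mx * e) \<le> 2 * (1 + t) * (k * ax) * (m * (i + e))"
      unfolding a[symmetric] eqs(1)[symmetric] eqs(2)[symmetric] .
    then have "(ax * mx * e) * (b * ((1 + R) * (1 + r) + 1))
        \<le> (ax * mx * e) * (2 * k * (1 + t) * ((1 + R) * (1 + r)))"
      unfolding eqs by (simp add: algebra_simps)
    then show ?thesis using pos by (simp only: mult_le_cancel_left_pos mult_pos_pos)
  qed
  show False by (rule branching_ratio_contradiction[OF k0 kr rR t lower upper])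
qed

section \<open>Core vertices have degree at most two\<close>

text \<open>By \<open>core_V_iff\<close> these are the non-core vertices of the tree. They become
  the vertices added at the joins of the tree of stars.\<close>

definition (in tree_graph) hubs :: "'a set" where
  "hubs = {v. \<exists>w. adjacent E v w \<and> cr v w}"

context tree_graph
begin

text \<open>If \<open>cr v w\<close> failed, orientation would give \<open>cr w v\<close>, which
  forbids \<open>v\<close> any core child other than \<open>w\<close>.\<close>

lemma hubs_cr:
  assumes oriented: "\<And>a b. adjacent E a b \<Longrightarrow> cr a b \<longleftrightarrow> \<not> cr b a"
    and v: "v \<in> hubs" and vw: "adjacent E v w"
  shows "cr v w"
proof (rule ccontr)
  assume n: "\<not> cr v w"
  obtain w' where w': "adjacent E v w'" "cr v w'" using v unfolding hubs_def by blast
  have "cr w v" using oriented[OF vw] n by blast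
  then show False using cr_iff[OF adjacent_sym[OF vw]] w' n by blast
qed

lemma hubs_bipartite:
  assumes oriented: "\<And>a b. adjacent E a b \<Longrightarrow> cr a b \<longleftrightarrow> \<not> cr b a"
    and ab: "adjacent E a b"
  shows "a \<in> hubs \<longleftrightarrow> b \<notin> hubs"
  using oriented[OF ab] hubs_cr[OF oriented _ ab] hubs_cr[OF oriented _ adjacent_sym[OF ab]]
    ab adjacent_sym[OF ab] unfolding hubs_def by blast

lemma hubs_degree:
  assumes oriented: "\<And>a b. adjacent E a b \<Longrightarrow> cr a b \<longleftrightarrow> \<not> cr b a" and v: "v \<in> hubs"
  shows "2 \<le> card (nb v)"
proof -
  obtain w where w: "adjacent E v w" "cr v w" using v unfolding hubs_def by blast
  then have "\<not> cr w v" using oriented by blast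
  then obtain w' where w': "adjacent E v w'" "w' \<noteq> w" using cr_iff[OF adjacent_sym[OF w(1)]] by blast
  have "card {w, w'} \<le> card (nb v)" using w(1) w' finite_nb by (intro card_mono) auto
  then show ?thesis using w'(2) by simp
qed

end

context extremal_graph
begin

text \<open>Suppose \<open>x\<close> has three branches. Let \<open>y1\<close> be its least likely neighbour within its own
  branch, \<open>y3\<close> the next one, \<open>l\<close> a leaf behind \<open>y1\<close> with neighbour \<open>p\<close>, and \<open>z\<close> a child of
  \<open>y1\<close> whose branch does not contain \<open>p\<close>. Since moving the branch at \<open>y3\<close> from \<open>x\<close> to \<open>l\<close> or
  to \<open>z\<close> does not help, \<open>p\<close> is about twice as likely as \<open>y1\<close> or more; since moving the branch at
  \<open>z\<close> from \<open>y1\<close> to \<open>p\<close> does not help, it is less than that. The two bounds agree to second order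
  in the ratios involved, so no estimate may be wasted.\<close>

lemma core_degree_le_2:
  assumes oriented: "\<And>a b. adjacent E a b \<Longrightarrow> cr a b \<longleftrightarrow> \<not> cr b a"
    and x_core: "\<And>y. adjacent E x y \<Longrightarrow> \<not> cr x y"
  shows "card (nb x) \<le> 2"
proof (rule ccontr)
  assume deg: "\<not> card (nb x) \<le> 2"
  \<comment> \<open>Odds instead of probabilities, because \<open>1 + rho y\<close> is the factor
    \<open>F (br x y) / F (br x y - {y})\<close> that a branch contributes to the ratio
    \<open>m / m0\<close> below.\<close>
  define rho :: "'a \<Rightarrow> real" where
    "rho y = real (ins (br x y) y) / real (F (br x y - {y}))" for y
  define y1 where "y1 = arg_min_on rho (nb x)"
  \<comment> \<open>The branch at \<open>y3\<close> is the one to be moved. Its middle place gives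
    both \<open>rho y1 \<le> rho y3\<close>, used for \<open>k \<le> r\<close>, and
    \<open>rho y3 \<le> rho y2\<close>, used for \<open>r \<le> R\<close>.\<close>
  define y3 where "y3 = arg_min_on rho (nb x - {y1})"
  have ne: "nb x \<noteq> {}" using deg by auto
  have y1: "y1 \<in> nb x" "\<And>y. y \<in> nb x \<Longrightarrow> rho y1 \<le> rho y"
    unfolding y1_def
    using arg_min_if_finite(1)[OF finite_nb ne] arg_min_least[OF finite_nb ne] by auto
  have c1: "card (nb x - {y1}) = card (nb x) - 1" using y1(1) by simp
  have ne3: "nb x - {y1} \<noteq> {}"
  proof
    assume "nb x - {y1} = {}"
    then have "card (nb x - {y1}) = 0" by (simp only: card.empty)
    then show False using c1 deg by linarith
  qed
  have fin3: "finite (nb x - {y1})" using finite_nb by simp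
  have y3: "y3 \<in> nb x - {y1}" "\<And>y. y \<in> nb x - {y1} \<Longrightarrow> rho y3 \<le> rho y"
    unfolding y3_def
    using arg_min_if_finite(1)[OF fin3 ne3] arg_min_least[OF fin3 ne3] by auto
  have "card (nb x - {y1} - {y3}) = card (nb x) - 2" using c1 y3(1) by simp
  then have "nb x - {y1} - {y3} \<noteq> {}" using deg by (metis card.empty diff_is_0_eq)
  then obtain y2 where y2: "y2 \<in> nb x" "y2 \<noteq> y1" "y2 \<noteq> y3" by blast
  have a1: "adjacent E x y1" and a2: "adjacent E x y2" and a3: "adjacent E x y3"
    using y1 y2 y3 by auto
  have b1: "adjacent E y1 x" and b3: "adjacent E y3 x" using adjacent_sym[OF a1] adjacent_sym[OF a3] .
  have n31: "y3 \<noteq> y1" using y3 by blast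
  have rho_le: "rho y1 \<le> rho y3" "rho y3 \<le> rho y2" "rho y1 \<le> rho y2"
    using y1(2) y3 y2 by auto
  have Fpos: "0 < real (F (br x y - {y}))" if "adjacent E x y" for y
    using F_pos finite_br[OF that] by simp
  have rho_cross: "ins (br x y) y * F (br x y' - {y'}) \<le> ins (br x y') y' * F (br x y - {y})"
    if "adjacent E x y" "adjacent E x y'" "rho y \<le> rho y'" for y y'
  proof -
    have "real (ins (br x y) y) * real (F (br x y' - {y'}))
        \<le> real (ins (br x y') y') * real (F (br x y - {y}))"
      using that(3) Fpos[OF that(1)] Fpos[OF that(2)] unfolding rho_def by (simp add: field_simps)
    then show ?thesis by (metis of_nat_le_iff of_nat_mult)
  qed

  \<comment> \<open>Moving the branch at \<open>y3\<close> away from \<open>x\<close>\<close>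
  define Y1 where "Y1 = br x y1"
  define Y2 where "Y2 = br x y2"
  define Y3 where "Y3 = br x y3"
  define U where "U = br y3 x"
  define M where "M = U - {x} - Y1"
  define m where "m = F M"
  define m0 where "m0 = F (M - nb x)"
  have fin: "finite Y1" "finite Y2" "finite Y3" "finite U" "finite M"
    using finite_br[OF a1] finite_br[OF a2] finite_br[OF a3] finite_br[OF b3]
    by (auto simp: Y1_def Y2_def Y3_def U_def M_def)
  have nbx: "Y1 \<inter> nb x = {y1}" "Y2 \<inter> nb x = {y2}" "Y3 \<inter> nb x = {y3}"
    using br_Int_nb[OF a1] br_Int_nb[OF a2] br_Int_nb[OF a3] by (auto simp: Y1_def Y2_def Y3_def)
  have xnot: "x \<notin> Y1" "x \<notin> Y2" "x \<notin> Y3" using br_notin[OF a1] br_notin[OF a2] br_notin[OF a3] by (auto simp: Y1_def Y2_def Y3_def)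
  have xU: "x \<in> U" using br_self by (simp add: U_def)
  have y1Y: "y1 \<in> Y1" using br_self by (simp add: Y1_def)
  have Y1U: "Y1 \<subseteq> U - {x}" and Y2U: "Y2 \<subseteq> U - {x}"
    using br_child_subset[OF b3 a1] br_child_subset[OF b3 a2] n31 y2 by (auto simp: Y1_def Y2_def U_def)
  have Y12: "Y1 \<inter> Y2 = {}" using br_children_disjoint[OF a1 a2] y2 by (auto simp: Y1_def Y2_def)
  have sepYM: "separated Y1 M" using br_separated[OF a1, of U] by (simp add: M_def Y1_def)
  have Ux: "U - {x} = Y1 \<union> M" using Y1U by (auto simp: M_def)
  have mpos: "0 < m" "0 < m0" using F_pos fin by (auto simp: m_def m0_def)
  have FxM: "F (insert x M) = m + m0"
    using F_rec[of "insert x M" x] fin by (simp add: M_def m_def m0_def)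
  have insUx: "ins U x = F (Y1 - {y1}) * m0"
  proof -
    have "U - {x} - nb x = (Y1 - {y1}) \<union> (M - nb x)" using Ux nbx(1) by blast
    moreover have "separated (Y1 - {y1}) (M - nb x)" by (rule separated_subset[OF sepYM]) auto
    ultimately show ?thesis by (simp add: F_Un m0_def)
  qed
  \<comment> \<open>Since \<open>cr x y3\<close> fails, every vertex of \<open>U\<close> is an
    admissible new attachment.\<close>
  have toU: "ins U u' \<le> F (Y1 - {y1}) * m0" if "u' \<in> U" for u'
    using move[OF a3, of u'] that x_core[OF a3] insUx unfolding U_def by auto
  \<comment> \<open>The branches inside \<open>M\<close> other than \<open>Y2\<close> can only
    increase \<open>m / m0\<close>.\<close>
  have mY2: "m0 * F Y2 \<le> m * F (Y2 - {y2})"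
  proof -
    define R where "R = M - Y2"
    have Y2M: "Y2 \<subseteq> M" using Y2U Y12 by (auto simp: M_def)
    have sep: "separated Y2 R"
      by (rule separated_subset[OF br_separated[OF a2, of U]]) (auto simp: Y2_def R_def M_def)
    have "M = Y2 \<union> R" using Y2M by (auto simp: R_def)
    then have 1: "m = F Y2 * F R" using F_Un[OF sep] by (simp add: m_def)
    have "M - nb x = (Y2 - {y2}) \<union> (R - nb x)" using Y2M nbx(2) unfolding R_def by blast
    moreover have "separated (Y2 - {y2}) (R - nb x)" by (rule separated_subset[OF sep]) auto
    ultimately have 2: "m0 = F (Y2 - {y2}) * F (R - nb x)" by (simp add: F_Un m0_def)
    have "F (R - nb x) \<le> F R" using fin by (intro F_mono) (auto simp: R_def)
    then show ?thesis unfolding 1 2 by simp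
  qed

  have childY: "br y1 z \<subseteq> Y1 - {y1}" if "adjacent E y1 z" "z \<noteq> x" for z
    using br_child_subset[OF a1 that] by (simp add: Y1_def)
  have Y1_out: "\<not> adjacent E a b" if "a \<in> Y1 - {y1}" "b \<notin> Y1" for a b
    using br_closed[OF a1, of a b] that by (auto simp: Y1_def)

  \<comment> \<open>Reattaching at a child \<open>z\<close> of \<open>y1\<close> bounds the odds of
    \<open>z\<close> in its branch by \<open>m0 / m\<close>.\<close>
  have light: "ins (br y1 z) z * m \<le> m0 * F (br y1 z - {z})" if z: "adjacent E y1 z" "z \<noteq> x" for z
  proof -
    define Z where "Z = br y1 z"
    define Q where "Q = Y1 - {y1} - Z"
    have ZY: "Z \<subseteq> Y1 - {y1}" using childY[OF z] by (simp add: Z_def)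
    have zZ: "z \<in> Z" using br_self by (simp add: Z_def)
    have fZ: "finite Z" using finite_br[OF z(1)] by (simp add: Z_def)
    have sepZ: "separated Z (U - {y1} - Z)" using br_separated[OF z(1)] by (simp add: Z_def)
    have nbz: "w = y1 \<or> w \<in> Z" if "adjacent E z w" for w
      using nb_Int_br[OF z(1)] that mem_nb unfolding Z_def by blast
    have e: "U - {z} - nb z = (Z - {z} - nb z) \<union> (Q \<union> insert x M)"
    proof -
      have "U = insert y1 (Z \<union> Q \<union> insert x M)" using Ux xU ZY y1Y by (auto simp: Q_def)
      moreover have "y1 \<in> nb z" using adjacent_sym[OF z(1)] by simp
      moreover have "nb z \<subseteq> insert y1 Z" using nbz mem_nb by blast
      moreover have "Z \<inter> (Q \<union> insert x M) = {}" "y1 \<notin> Q \<union> insert x M"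
        using ZY y1Y xnot by (auto simp: Q_def M_def)
      ultimately show ?thesis using zZ by blast
    qed
    have s1: "separated (Z - {z} - nb z) (Q \<union> insert x M)"
      by (rule separated_subset[OF sepZ]) (use Y1U ZY y1Y xU xnot in \<open>auto simp: Q_def M_def\<close>)
    have s2: "separated Q (insert x M)"
      unfolding separated_def using Y1_out xnot by (auto simp: Q_def M_def)
    have "ins U z = ins Z z * (F Q * (m + m0))" unfolding e F_Un[OF s1] F_Un[OF s2] FxM ..
    moreover have "F (Y1 - {y1}) = F Z * F Q"
    proof -
      have "Y1 - {y1} = Z \<union> Q" using ZY by (auto simp: Q_def)
      moreover have "separated Z Q"
        by (rule separated_subset[OF sepZ]) (use Y1U in \<open>auto simp: Q_def\<close>)
      ultimately show ?thesis by (simp add: F_Un)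
    qed
    ultimately have "F Q * (ins Z z * (m + m0)) \<le> F Q * (F Z * m0)"
      using toU[of z] ZY zZ Y1U by (auto simp: mult_ac)
    moreover have "0 < F Q" using fin by (intro F_pos) (auto simp: Q_def)
    ultimately have "ins Z z * (m + m0) \<le> F Z * m0" by simp
    then show ?thesis using F_rec[OF fZ zZ] unfolding Z_def by (simp add: algebra_simps)
  qed
  have m0m: "m0 < m"
  proof -
    have "F Y2 = F (Y2 - {y2}) + ins Y2 y2"
      using F_rec[OF fin(2), of y2] br_self by (simp add: Y2_def)
    moreover have "0 < ins Y2 y2" using fin by (intro F_pos) auto
    ultimately have "m0 * F (Y2 - {y2}) < m0 * F Y2" using mpos by simp
    then have "m0 * F (Y2 - {y2}) < m * F (Y2 - {y2})" using mY2 by linarith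
    then show ?thesis by simp
  qed

  \<comment> \<open>A second child of \<open>y1\<close> and a leaf behind it\<close>
  obtain z where z: "adjacent E y1 z" "z \<noteq> x" using x_core[OF a1] cr_iff[OF a1] by blast
  define Z where "Z = br y1 z"
  have ZY: "Z \<subseteq> Y1 - {y1}" using childY[OF z] by (simp add: Z_def)
  have zZ: "z \<in> Z" using br_self by (simp add: Z_def)
  have fZ: "finite Z" using finite_br[OF z(1)] by (simp add: Z_def)
  \<comment> \<open>If even the least likely neighbour were heavy, so would be \<open>y2\<close>;
    but \<open>x\<close> is heavy seen from \<open>y3\<close> and cannot have two heavy
    children.\<close>
  have "\<not> heavy x y1"
  proof
    assume h1: "heavy x y1"
    have "F (Y1 - {y1}) * F (Y2 - {y2}) \<le> 2 * ins Y1 y1 * F (Y2 - {y2})"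
      using h1 unfolding heavy_def Y1_def by (intro mult_le_mono) auto
    also have "\<dots> \<le> 2 * ins Y2 y2 * F (Y1 - {y1})"
      using rho_cross[OF a1 a2 rho_le(3)] unfolding Y1_def Y2_def by simp
    finally have "F (Y1 - {y1}) * F (Y2 - {y2}) \<le> F (Y1 - {y1}) * (2 * ins Y2 y2)"
      by (simp add: mult_ac)
    moreover have "0 < F (Y1 - {y1})" using fin by (intro F_pos) auto
    ultimately have "heavy x y2" by (simp add: heavy_def Y2_def)
    then show False
      using heavy_two_children[OF b3 heavy_if_not_cr[OF b3 x_core[OF a3]] a1 _ h1 a2] n31 y2 by blast
  qed
  \<comment> \<open>With \<open>z\<close> as its only child, \<open>y1\<close> would be heavy, as
    deleting \<open>z\<close> at most halves the count.\<close>
  have "\<exists>z'. adjacent E y1 z' \<and> z' \<noteq> x \<and> z' \<noteq> z"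
  proof (rule ccontr)
    assume no: "\<not> (\<exists>z'. adjacent E y1 z' \<and> z' \<noteq> x \<and> z' \<noteq> z)"
    have "Y1 - {y1} = Z"
    proof
      show "Y1 - {y1} \<subseteq> Z"
      proof
        fix w assume "w \<in> Y1 - {y1}"
        then have w: "w \<in> br x y1" "w \<noteq> y1" by (auto simp: Y1_def)
        obtain v where "adjacent E y1 v" "v \<noteq> x" "w \<in> br y1 v" using br_decomp[OF w] by blast
        then show "w \<in> Z" using no unfolding Z_def by blast
      qed
    qed (rule ZY)
    moreover have "Z - nb y1 = Z - {z}" using br_Int_nb[OF z(1)] unfolding Z_def by blast
    ultimately have "heavy x y1"
      using F_le_double[OF fZ, of z] unfolding heavy_def Y1_def by simp
    then show False using \<open>\<not> heavy x y1\<close> by simp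
  qed
  then obtain z' where z': "adjacent E y1 z'" "z' \<noteq> x" "z' \<noteq> z" by blast
  obtain l p where l: "l \<in> br y1 z'" "nb l = {p}" using leaf_in_br[OF z'(1)] by blast
  have lp: "adjacent E l p" using l(2) mem_nb by blast
  have pl: "adjacent E p l" using adjacent_sym[OF lp] .
  have l_only: "w = p" if "adjacent E l w" for w using that l(2) mem_nb by blast
  \<comment> \<open>A one-vertex branch has odds one, but \<open>light\<close> with
    \<open>m0 < m\<close> makes the odds of a child of \<open>y1\<close> less than one. So
    \<open>p\<close> lies behind \<open>y1\<close> as well.\<close>
  have "l \<noteq> z'"
  proof
    assume [simp]: "l = z'"
    have "br y1 z' = {z'}"
    proof -
      have False if w: "w \<in> br y1 z'" "w \<noteq> z'" for w
      proof -
        obtain v where "adjacent E z' v" "v \<noteq> y1" using br_decomp[OF w] by blast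
        then show False using l_only adjacent_sym[OF z'(1)] by auto
      qed
      then show ?thesis using br_self by blast
    qed
    then have "ins {z'} z' * m \<le> m0 * F {}" using light[OF z'(1,2)] by simp
    then have "F {} * m \<le> F {} * m0" by (simp add: mult_ac)
    moreover have "0 < F {}" by (rule F_pos) simp
    ultimately show False using m0m by simp
  qed
  have pbr: "p \<in> br y1 z'" using br_closed[OF z'(1) l(1) \<open>l \<noteq> z'\<close> lp] .
  have sub': "br y1 z' \<subseteq> Y1 - {y1}" using childY[OF z'(1,2)] .
  have disj': "br y1 z' \<inter> Z = {}" using br_children_disjoint[OF z'(1) z(1) z'(3)] by (simp add: Z_def)
  have py1: "p \<noteq> y1" "l \<noteq> y1" "l \<noteq> p" using pbr l(1) sub' irrefl lp by auto
  have pY: "p \<in> Y1" "l \<in> Y1" "p \<notin> Z" "l \<notin> Z" using pbr l(1) sub' disj' by auto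
  have nbp: "nb p \<subseteq> Y1" using Y1_out[of p] pY py1 mem_nb by blast

  have "x \<notin> hubs" using x_core by (auto simp: hubs_def)
  then have y1A: "y1 \<in> hubs" using hubs_bipartite[OF oriented a1] by blast
  have crx: "cr y1 x" using hubs_cr[OF oriented y1A b1] .
  \<comment> \<open>This puts \<open>p\<close> on the same side as \<open>y1\<close>, as
    \<open>same_side_correlation\<close> requires.\<close>
  have pA: "p \<in> hubs"
  proof -
    have "l \<notin> hubs"
    proof
      assume "l \<in> hubs"
      then have "cr l p" using hubs_cr[OF oriented _ lp] by blast
      moreover have "cr p l" unfolding cr_iff[OF pl] using l_only by blast
      ultimately show False using oriented[OF lp] by blast
    qed
    then show ?thesis using hubs_bipartite[OF oriented lp] by blast
  qed
  have pny: "p \<notin> nb y1" "y1 \<notin> nb p" "l \<notin> nb y1"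
  proof -
    show "p \<notin> nb y1" using hubs_bipartite[OF oriented, of y1 p] pA y1A by auto
    show "y1 \<notin> nb p" using hubs_bipartite[OF oriented, of p y1] pA y1A by auto
    show "l \<notin> nb y1" using l_only adjacent_sym[of E y1 l] py1 by auto
  qed
  have lnb: "X - nb l = X - {p}" for X using l(2) by simp

  \<comment> \<open>Joint counts for \<open>y1\<close> and \<open>p\<close>\<close>
  define G where "G = Y1 - {l, p, y1}"
  \<comment> \<open>The first index tells whether \<open>y1\<close> is in the set, the second
    whether \<open>p\<close> is. The leaf \<open>l\<close> is left out of \<open>G\<close>, so the
    patterns without \<open>p\<close> get a factor two whenever \<open>l\<close> is present.\<close>
  define a00 where "a00 = F G"
  define a01 where "a01 = F (G - nb p)"
  define a10 where "a10 = F (G - nb y1)"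
  define a11 where "a11 = F (G - nb p - nb y1)"
  have fG: "finite G" using fin by (simp add: G_def)
  have corr: "a01 * a10 \<le> a11 * a00"
  proof -
    have e: "Y1 - {l} - {p, y1} = G" by (auto simp: G_def)
    show ?thesis
      using same_side_correlation[of "Y1 - {l}" p hubs y1] fin pY py1 pA y1A y1Y hubs_bipartite[OF oriented]
      unfolding e a00_def a01_def a10_def a11_def by auto
  qed
  have out1: "F (Y1 - {y1}) = 2 * a00 + a01"
  proof -
    have "F (Y1 - {y1}) = F (Y1 - {y1} - {p}) + F (Y1 - {y1} - {p} - nb p)"
      using fin pY py1 by (intro F_rec) auto
    moreover have "F (Y1 - {y1} - {p}) = F G + F G"
    proof -
      have "Y1 - {y1} - {p} - {l} = G" "Y1 - {y1} - {p} - {l} - nb l = G"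
        using lnb by (auto simp: G_def)
      then show ?thesis using F_rec[of "Y1 - {y1} - {p}" l] fin pY py1 by simp
    qed
    moreover have "Y1 - {y1} - {p} - nb p = G - nb p" using pl by (auto simp: G_def)
    ultimately show ?thesis by (simp add: a00_def a01_def)
  qed
  have ins1: "ins Y1 y1 = 2 * a10 + a11"
  proof -
    let ?H = "Y1 - {y1} - nb y1"
    have "F ?H = F (?H - {p}) + F (?H - {p} - nb p)"
      using fin pY py1 pny by (intro F_rec) auto
    moreover have "F (?H - {p}) = F (G - nb y1) + F (G - nb y1)"
    proof -
      have "?H - {p} - {l} = G - nb y1" "?H - {p} - {l} - nb l = G - nb y1"
        using lnb by (auto simp: G_def)
      then show ?thesis using F_rec[of "?H - {p}" l] fin pY py1 pny by simp
    qed
    moreover have "?H - {p} - nb p = G - nb p - nb y1" using pl by (auto simp: G_def)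
    ultimately show ?thesis by (simp add: a10_def a11_def)
  qed
  \<comment> \<open>Reattaching the branch at \<open>y3\<close> to \<open>l\<close>. Putting
    \<open>l\<close> in only removes \<open>p\<close>, so the outcome is a lower bound on
    \<open>a01\<close>.\<close>
  have ineqA: "m * (a00 + a10) + m0 * a00 \<le> m0 * (2 * a00 + a01)"
  proof -
    have "ins U l = F (U - {l} - {p})" using lnb by simp
    also have "\<dots> = F (U - {l} - {p} - {x}) + F (U - {l} - {p} - {x} - nb x)"
      using fin xU pY xnot by (intro F_rec) auto
    also have "U - {l} - {p} - {x} = (Y1 - {l, p}) \<union> M" using Ux pY by (auto simp: M_def)
    also have "F \<dots> = F (Y1 - {l, p}) * m"
      unfolding m_def by (rule F_Un, rule separated_subset[OF sepYM]) auto
    also have "F (Y1 - {l, p}) = a00 + a10"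
    proof -
      have "Y1 - {l, p} - {y1} = G" by (auto simp: G_def)
      then show ?thesis using F_rec[of "Y1 - {l, p}" y1] fin y1Y py1 by (simp add: a00_def a10_def)
    qed
    also have "(Y1 - {l, p}) \<union> M - nb x = G \<union> (M - nb x)" using nbx(1) y1Y by (auto simp: G_def)
    also have "F \<dots> = a00 * m0"
      unfolding m0_def a00_def
      by (rule F_Un, rule separated_subset[OF sepYM]) (auto simp: G_def)
    finally show ?thesis using toU[of l] pY Y1U out1 by (auto simp: algebra_simps)
  qed

  \<comment> \<open>Moving the branch at \<open>z\<close> from \<open>y1\<close> to
    \<open>p\<close>\<close>
  define Q where "Q = Y1 - {y1} - Z"
  define X where "X = br y1 x"
  define W where "W = br z y1"
  define c01 where "c01 = F (Q - {p} - nb p)"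
  define c10 where "c10 = F (Q - {p, l} - nb y1)"
  have pQ: "p \<in> Q" "l \<in> Q" using pY py1 by (auto simp: Q_def)
  have zy1: "adjacent E z y1" using adjacent_sym[OF z(1)] .
  have YX: "Y1 \<union> X = V" "Y1 \<inter> X = {}"
    using br_cover[OF a1] br_disjoint[OF a1] by (auto simp: Y1_def X_def)
  have "Z \<union> W = V" "Z \<inter> W = {}"
    using br_cover[OF z(1)] br_disjoint[OF z(1)] by (auto simp: Z_def W_def)
  then have W: "W = insert y1 (Q \<union> X)" using YX ZY y1Y by (auto simp: Q_def)
  have fX: "finite X" using finite_br[OF b1] by (simp add: X_def)
  have fQ: "finite Q" using fin by (simp add: Q_def)
  have sepZQ: "separated Z Q"
    by (rule separated_subset[OF br_separated[OF z(1), of Y1]]) (auto simp: Z_def Q_def)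
  have sepQX: "separated Q X"
    unfolding separated_def using Y1_out YX by (auto simp: Q_def)
  have y1X: "y1 \<notin> X" "y1 \<notin> Q" using y1Y YX by (auto simp: Q_def)
  have XY3: "X - {x} = M \<union> Y3"
  proof -
    have "U \<union> Y3 = V" "U \<inter> Y3 = {}"
      using br_cover[OF a3] br_disjoint[OF a3] by (auto simp: U_def Y3_def)
    then show ?thesis using YX xnot Y1U by (auto simp: M_def)
  qed
  have sep3: "separated Y3 M"
    by (rule separated_subset[OF br_separated[OF a3, of U]])
      (use br_disjoint[OF a3] in \<open>auto simp: Y3_def U_def M_def\<close>)
  have q: "F (X - {x}) = m * F Y3"
    using F_Un[OF sep3] unfolding XY3 by (simp add: m_def Un_commute mult.commute)
  have q0: "F (X - {x} - nb x) = m0 * F (Y3 - {y3})"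
  proof -
    have "X - {x} - nb x = (Y3 - {y3}) \<union> (M - nb x)" unfolding XY3 using nbx(3) by blast
    moreover have "separated (Y3 - {y3}) (M - nb x)" by (rule separated_subset[OF sep3]) auto
    ultimately show ?thesis by (simp add: F_Un m0_def)
  qed
  have FX: "F X = m * F Y3 + m0 * F (Y3 - {y3})"
    using F_rec[OF fX, of x] br_self q q0 by (simp add: X_def)
  have ineqC: "c01 * (m * F Y3 + m0 * F (Y3 - {y3})) \<le> 2 * c10 * (m * F Y3)"
  proof -
    have fW: "finite W" using finite_br[OF zy1] by (simp add: W_def)
    \<comment> \<open>Neither \<open>y1\<close> nor \<open>p\<close> is core in \<open>W\<close>,
      the former because of \<open>x\<close> and the latter because of its leaf \<open>l\<close>, so
      the move keeps the stability number.\<close>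
    have "\<not> cr z y1" unfolding cr_iff[OF zy1] using crx b1 z(2) by blast
    moreover have "\<not> core W p"
    proof (rule leaf_support_not_core[OF fW])
      show "l \<in> W" "p \<in> W" "nb l \<inter> W = {p}" using W pQ l(2) by auto
    qed
    ultimately have "ins W p \<le> ins W y1"
      using move[OF z(1), of p] pQ W unfolding W_def by auto
    moreover have "ins W p = F (W - {p} - nb p - {y1}) + F (W - {p} - nb p - {y1} - nb y1)"
      using fW W pny py1 by (intro F_rec) auto
    moreover have "ins W y1 = F (W - {y1} - nb y1 - {p}) + F (W - {y1} - nb y1 - {p} - nb p)"
      using fW W pny py1 pQ by (intro F_rec) auto
    \<comment> \<open>The stable sets containing both \<open>y1\<close> and \<open>p\<close> appear
      on both sides and cancel.\<close>
    moreover have "W - {y1} - nb y1 - {p} - nb p = W - {p} - nb p - {y1} - nb y1" by auto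
    ultimately have "F (W - {p} - nb p - {y1}) \<le> F (W - {y1} - nb y1 - {p})" by simp
    moreover have "F (W - {p} - nb p - {y1}) = c01 * F X"
    proof -
      have "p \<notin> X" "nb p \<inter> X = {}" using nbp YX pY by auto
      then have "W - {p} - nb p - {y1} = (Q - {p} - nb p) \<union> X" using W y1X by auto
      moreover have "separated (Q - {p} - nb p) X" by (rule separated_subset[OF sepQX]) auto
      ultimately show ?thesis by (simp add: F_Un c01_def)
    qed
    moreover have "F (W - {y1} - nb y1 - {p}) = 2 * c10 * F (X - {x})"
    proof -
      have "X \<inter> nb y1 = {x}" using br_Int_nb[OF b1] by (simp add: X_def)
      moreover have "p \<notin> X" using YX pY by auto
      ultimately have "W - {y1} - nb y1 - {p} = (Q - {p} - nb y1) \<union> (X - {x})" using W y1X by auto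
      moreover have "separated (Q - {p} - nb y1) (X - {x})" by (rule separated_subset[OF sepQX]) auto
      moreover have "F (Q - {p} - nb y1) = c10 + c10"
      proof -
        have "Q - {p} - nb y1 - {l} = Q - {p, l} - nb y1"
          "Q - {p} - nb y1 - {l} - nb l = Q - {p, l} - nb y1" using lnb by auto
        then show ?thesis using F_rec[of "Q - {p} - nb y1" l] fQ pQ py1 pny by (simp add: c10_def)
      qed
      ultimately show ?thesis by (simp add: F_Un)
    qed
    ultimately show ?thesis using FX q by simp
  qed
  have a01: "a01 = F Z * c01"
  proof -
    have "\<not> adjacent E p w" if "w \<in> Z" for w
      using sepZQ pQ(1) that adjacent_sym[of E p w] unfolding separated_def by blast
    then have "nb p \<inter> Z = {}" using mem_nb by blast
    then have "G - nb p = Z \<union> (Q - {p} - nb p)"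
      using ZY pY pl by (auto simp: G_def Q_def)
    moreover have "separated Z (Q - {p} - nb p)" by (rule separated_subset[OF sepZQ]) auto
    ultimately show ?thesis by (simp add: F_Un a01_def c01_def)
  qed
  have a10: "a10 = F (Z - {z}) * c10"
  proof -
    have "Z \<inter> nb y1 = {z}" using br_Int_nb[OF z(1)] by (simp add: Z_def)
    then have "G - nb y1 = (Z - {z}) \<union> (Q - {p, l} - nb y1)"
      using ZY pY by (auto simp: G_def Q_def)
    moreover have "separated (Z - {z}) (Q - {p, l} - nb y1)" by (rule separated_subset[OF sepZQ]) auto
    ultimately show ?thesis by (simp add: F_Un a10_def c10_def)
  qed
  have FZ: "F Z = ins Z z + F (Z - {z})" using F_rec[OF fZ zZ] by simp
  have FY3: "F Y3 = ins Y3 y3 + F (Y3 - {y3})"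
    using F_rec[OF fin(3), of y3] br_self by (simp add: Y3_def)
  have min: "(2 * a10 + a11) * F (Y3 - {y3}) \<le> ins Y3 y3 * (2 * a00 + a01)"
    using rho_cross[OF a1 a3 rho_le(1)] unfolding Y1_def[symmetric] Y3_def[symmetric] ins1 out1 .
  \<comment> \<open>In ratios: \<open>1 + rho y3 \<le> 1 + rho y2 \<le> m / m0\<close>, the second
    step being \<open>mY2\<close>.\<close>
  have le: "m0 * F Y3 \<le> m * F (Y3 - {y3})"
  proof -
    have "ins Y3 y3 * F (Y2 - {y2}) \<le> ins Y2 y2 * F (Y3 - {y3})"
      using rho_cross[OF a3 a2 rho_le(2)] unfolding Y2_def Y3_def .
    moreover have "F Y2 = ins Y2 y2 + F (Y2 - {y2})"
      using F_rec[OF fin(2), of y2] br_self by (simp add: Y2_def)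
    ultimately have "F Y3 * F (Y2 - {y2}) \<le> F Y2 * F (Y3 - {y3})"
      using FY3 by (simp add: algebra_simps)
    then have "m0 * (F Y3 * F (Y2 - {y2})) \<le> m0 * (F Y2 * F (Y3 - {y3}))" by simp
    also have "\<dots> = (m0 * F Y2) * F (Y3 - {y3})" by simp
    also have "\<dots> \<le> (m * F (Y2 - {y2})) * F (Y3 - {y3})" using mY2 by (rule mult_le_mono1)
    finally have "(m0 * F Y3) * F (Y2 - {y2}) \<le> (m * F (Y3 - {y3})) * F (Y2 - {y2})"
      by (simp add: mult_ac)
    moreover have "0 < F (Y2 - {y2})" using fin by (intro F_pos) auto
    ultimately show ?thesis by simp
  qed
  have pos: "0 < a00" "0 < c10" "0 < F (Y3 - {y3})" "0 < F (Z - {z})"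
    using F_pos fG fQ fZ fin by (auto simp: a00_def c10_def)
  have reals: "real m * (real a00 + real a10) + real m0 * real a00 \<le> real m0 * (2 * real a00 + real a01)"
    "real (ins Z z) * real m \<le> real m0 * real (F (Z - {z}))"
    "real c01 * (real m * (real (ins Y3 y3) + real (F (Y3 - {y3}))) + real m0 * real (F (Y3 - {y3})))
      \<le> 2 * real c10 * (real m * (real (ins Y3 y3) + real (F (Y3 - {y3}))))"
    "real a01 = (real (ins Z z) + real (F (Z - {z}))) * real c01"
    "real a10 = real (F (Z - {z})) * real c10"
    "real a01 * real a10 \<le> real a11 * real a00"
    "(2 * real a10 + real a11) * real (F (Y3 - {y3})) \<le> real (ins Y3 y3) * (2 * real a00 + real a01)"
    "real m0 * (real (ins Y3 y3) + real (F (Y3 - {y3}))) \<le> real m * real (F (Y3 - {y3}))"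
    using of_nat_mono[OF ineqA, where 'a = real]
      of_nat_mono[OF light[OF z, folded Z_def], where 'a = real]
      of_nat_mono[OF ineqC[unfolded FY3], where 'a = real]
      arg_cong[OF a01[unfolded FZ], where f = real] arg_cong[OF a10, where f = real]
      of_nat_mono[OF corr, where 'a = real] of_nat_mono[OF min, where 'a = real]
      of_nat_mono[OF le[unfolded FY3], where 'a = real]
    by (simp_all only: of_nat_add of_nat_mult of_nat_numeral)
  show False
    by (rule branching_count_contradiction[OF _ _ _ _ _ _ _ _ _ reals]) (use pos mpos in simp_all)
qed

end

section \<open>Recognising paths and trees of stars\<close>

context tree_graph
begin

lemma degree_eq_card_nb: "degree E v = card (nb v)"
proof -
  have "{e \<in> E. v \<in> e} = (\<lambda>w. {v, w}) ` nb v"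
  proof
    show "{e \<in> E. v \<in> e} \<subseteq> (\<lambda>w. {v, w}) ` nb v"
    proof
      fix e assume e: "e \<in> {e \<in> E. v \<in> e}"
      then have "card e = 2" using simple by (auto simp: simple_graph_def)
      then obtain w where "e = {v, w}" using e by (auto simp: card_2_iff)
      then show "e \<in> (\<lambda>w. {v, w}) ` nb v" using e by (auto simp: nb_def adjacent_def)
    qed
  qed (auto simp: nb_def adjacent_def)
  moreover have "inj_on (\<lambda>w. {v, w}) (nb v)" by (rule inj_onI) (auto simp: doubleton_eq_iff)
  ultimately show ?thesis by (simp add: degree_def card_image)
qed

lemma isolated:
  assumes "v \<in> V" "nb v = {}"
  shows "V = {v}" "E = {}"
proof -
  have "w = v" if w: "w \<in> V" for w
  proof (rule ccontr)
    assume "w \<noteq> v"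
    then obtain u where "adjacent E v u" using V_decomp[OF w assms(1)] by blast
    then show False using assms(2) mem_nb by blast
  qed
  then show V: "V = {v}" using assms(1) by blast
  have "e \<notin> E" for e
  proof
    assume "e \<in> E"
    then have "e \<subseteq> {v}" "card e = 2" using simple V by (auto simp: simple_graph_def)
    then show False using card_mono[of "{v}" e] by simp
  qed
  then show "E = {}" by blast
qed

lemma nb_induced_br:
  assumes "adjacent E u v" "w \<in> br u v"
  shows "{x. adjacent (induced E (br u v)) w x} = (if w = v then nb v - {u} else nb w)"
  using nb_Int_br[OF assms(1)] br_closed[OF assms] assms(2) by (auto simp: nb_def)

end

lemma consecutive_pairs_Cons:
  assumes "xs \<noteq> []"
  shows "{{(v # xs) ! i, (v # xs) ! Suc i} | i. Suc i < length (v # xs)}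
    = insert {v, hd xs} {{xs ! i, xs ! Suc i} | i. Suc i < length xs}" (is "?L = ?R")
proof
  show "?L \<subseteq> ?R"
  proof
    fix e assume "e \<in> ?L"
    then obtain i where i: "e = {(v # xs) ! i, (v # xs) ! Suc i}" "Suc i < length (v # xs)" by blast
    then show "e \<in> ?R" using assms by (cases i) (auto simp: hd_conv_nth)
  qed
  show "?R \<subseteq> ?L"
  proof
    fix e assume "e \<in> ?R"
    then consider "e = {v, hd xs}" | i where "e = {xs ! i, xs ! Suc i}" "Suc i < length xs" by blast
    then show "e \<in> ?L"
    proof cases
      case 1
      then show ?thesis using assms by (intro CollectI exI[of _ 0]) (auto simp: hd_conv_nth)
    next
      case 2
      then show ?thesis by (intro CollectI exI[of _ "Suc i"]) auto
    qed
  qed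
qed

text \<open>Peeling off the end \<open>v\<close> leaves a tree in which its neighbour
  \<open>u\<close> is an end. Prescribing the first vertex of the list lets the path of the smaller
  tree be extended by \<open>v\<close>.\<close>

lemma tree_max_degree_2_path:
  assumes "tree V E" "v \<in> V" "card {w. adjacent E v w} \<le> 1"
    and "\<And>u. u \<in> V \<Longrightarrow> card {w. adjacent E u w} \<le> 2"
  shows "\<exists>xs. xs \<noteq> [] \<and> hd xs = v \<and> distinct xs \<and> V = set xs
    \<and> E = {{xs ! i, xs ! Suc i} | i. Suc i < length xs} \<and> Suc (card E) = card V"
  using assms
proof (induction "card V" arbitrary: V E v rule: less_induct)
  case less
  interpret tree_graph V E by unfold_locales (rule less.prems)
  show ?case
  proof (cases "nb v = {}")
    case True
    from isolated[OF less.prems(2) this] show ?thesis by (intro exI[of _ "[v]"]) auto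
  next
    case False
    have "card (nb v) \<le> 1" using less.prems(3) by (simp add: nb_def)
    moreover have "card (nb v) \<noteq> 0" using False finite_nb by simp
    ultimately have "card (nb v) = 1" by linarith
    then obtain u where u: "nb v = {u}" by (auto simp: card_1_singleton_iff)
    have vu: "adjacent E v u" using u mem_nb by blast
    have only: "w = u" if "adjacent E v w" for w using that u mem_nb by blast
    define B where "B = br v u"
    define E' where "E' = induced E B"
    have vB: "v \<notin> B" using br_notin[OF vu] by (simp add: B_def)
    have V: "V = insert v B"
    proof
      show "V \<subseteq> insert v B"
      proof
        fix w assume w: "w \<in> V"
        show "w \<in> insert v B"
        proof (cases "w = v")
          case False
          then obtain u' where "adjacent E v u'" "w \<in> br v u'" using V_decomp[OF w less.prems(2)] by blast
          then show ?thesis using only B_def by blast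
        qed simp
      qed
      show "insert v B \<subseteq> V" using br_subset[OF vu] less.prems(2) by (simp add: B_def)
    qed
    have fB: "finite B" using finite_br[OF vu] by (simp add: B_def)
    have E: "E = insert {v, u} E'"
    proof -
      have "br u v = {v}"
        using br_cover[OF vu] br_disjoint[OF vu] V vB unfolding B_def[symmetric] by blast
      moreover have "e \<notin> induced E {v}" for e
      proof
        assume "e \<in> induced E {v}"
        then have "card e = 2" "e \<subseteq> {v}" using simple by (auto simp: induced_def simple_graph_def)
        then show False using card_mono[of "{v}" e] by simp
      qed
      ultimately have "induced E (br u v) = {}" by auto
      then show ?thesis using E_split[OF vu] unfolding E'_def B_def by simp
    qed
    have nbi: "{x. adjacent E' w x} = (if w = u then nb u - {v} else nb w)" if "w \<in> B" for w
      using nb_induced_br[OF vu] that unfolding E'_def B_def by blast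
    have uB: "u \<in> B" using br_self by (simp add: B_def)
    have deg: "card (nb w) \<le> 2" if "w \<in> V" for w using less.prems(4)[OF that] by (simp add: nb_def)
    have "v \<in> nb u" using adjacent_sym[OF vu] by simp
    then have du: "card (nb u - {v}) \<le> 1" using deg[of u] uB V by simp
    have "\<exists>xs. xs \<noteq> [] \<and> hd xs = u \<and> distinct xs \<and> B = set xs
      \<and> E' = {{xs ! i, xs ! Suc i} | i. Suc i < length xs} \<and> Suc (card E') = card B"
    proof (rule less.hyps)
      show "card B < card V" using V vB fB by simp
      show "tree B E'" using tree_br[OF vu] by (simp add: B_def E'_def)
      show "u \<in> B" by (rule uB)
      show "card {w. adjacent E' u w} \<le> 1" using nbi[OF uB] du by simp
      show "card {x. adjacent E' w x} \<le> 2" if "w \<in> B" for w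
        using nbi[OF that] du deg[of w] that V by simp
    qed
    then obtain xs where xs: "xs \<noteq> []" "hd xs = u" "distinct xs" "B = set xs"
      "E' = {{xs ! i, xs ! Suc i} | i. Suc i < length xs}" "Suc (card E') = card B" by blast
    have "finite E'" using fB unfolding E'_def induced_def by (auto intro: finite_subset[of _ "Pow B"])
    moreover have "{v, u} \<notin> E'" using vB by (auto simp: E'_def induced_def)
    ultimately have "Suc (card E) = card V" using xs(6) V vB fB E by simp
    moreover have "E = {{(v # xs) ! i, (v # xs) ! Suc i} | i. Suc i < length (v # xs)}"
      unfolding consecutive_pairs_Cons[OF xs(1)] xs(2) xs(5)[symmetric] by (rule E)
    ultimately show ?thesis using xs(3,4) V vB by (intro exI[of _ "v # xs"]) auto
  qed
qed

text \<open>Removing a vertex \<open>w\<close> of \<open>A\<close> takes a neighbour only from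
  vertices outside \<open>A\<close>, so both degree bounds persist in the branches and each
  \<open>v i\<close> becomes a leaf. If \<open>A\<close> misses \<open>V\<close>, no edge is
  possible and the tree is a single vertex.\<close>

lemma bipartite_tree_of_stars:
  assumes "tree V E"
    and "\<And>a b. adjacent E a b \<Longrightarrow> a \<in> A \<longleftrightarrow> b \<notin> A"
    and "\<And>v. v \<in> V \<Longrightarrow> v \<in> A \<Longrightarrow> 2 \<le> card {w. adjacent E v w}"
    and "\<And>v. v \<in> V \<Longrightarrow> v \<notin> A \<Longrightarrow> card {w. adjacent E v w} \<le> 2"
  shows "tree_of_stars V E"
  using assms
proof (induction "card V" arbitrary: V E rule: less_induct)
  case less
  interpret tree_graph V E by unfold_locales (rule less.prems)
  show ?case
  proof (cases "V \<inter> A = {}")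
    case True
    obtain v where v: "v \<in> V" using connected by (auto simp: connected_graph_def)
    have "\<not> adjacent E v w" for w
      using less.prems(2)[of v w] adjacent_V[of v w] True by blast
    then have "nb v = {}" by (simp add: nb_def)
    from isolated[OF v this] show ?thesis by (simp add: tree_of_stars.single)
  next
    case False
    then obtain w where w: "w \<in> V" "w \<in> A" by blast
    define k where "k = card (nb w)"
    obtain v where "bij_betw v {0..<k} (nb w)"
      using ex_bij_betw_nat_finite[OF finite_nb] unfolding k_def by blast
    then have v: "bij_betw v {..<k} (nb w)" by (simp add: atLeast0LessThan)
    have vw: "adjacent E w (v i)" if "i < k" for i
      using bij_betwE[OF v] that by simp
    have v_surj: "\<exists>i<k. u = v i" if "adjacent E w u" for u
    proof -
      have "u \<in> v ` {..<k}" using bij_betw_imp_surj_on[OF v] that by simp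
      then show ?thesis by blast
    qed
    have v_inj: "v i \<noteq> v j" if "i < k" "j < k" "i \<noteq> j" for i j
      using bij_betw_imp_inj_on[OF v] that by (auto simp: inj_on_def)
    define VS where "VS i = br w (v i)" for i
    define ES where "ES i = induced E (VS i)" for i
    have V: "V = insert w (\<Union>i<k. VS i)"
    proof
      show "V \<subseteq> insert w (\<Union>i<k. VS i)"
      proof
        fix x assume x: "x \<in> V"
        show "x \<in> insert w (\<Union>i<k. VS i)"
        proof (cases "x = w")
          case False
          then obtain u where u: "adjacent E w u" "x \<in> br w u" using V_decomp[OF x w(1)] by blast
          obtain i where "i < k" "u = v i" using v_surj[OF u(1)] by blast
          then show ?thesis using u(2) by (auto simp: VS_def)
        qed simp
      qed
      show "insert w (\<Union>i<k. VS i) \<subseteq> V" using w(1) br_subset[OF vw] by (auto simp: VS_def)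
    qed
    have E: "E = (\<Union>i<k. ES i) \<union> (\<lambda>i. {w, v i}) ` {..<k}"
    proof
      show "E \<subseteq> (\<Union>i<k. ES i) \<union> (\<lambda>i. {w, v i}) ` {..<k}"
      proof
        fix e assume e: "e \<in> E"
        then have "card e = 2" using simple by (auto simp: simple_graph_def)
        then obtain a b where ab: "e = {a, b}" by (auto simp: card_2_iff)
        then have adj: "adjacent E a b" using e by (simp add: adjacent_def)
        show "e \<in> (\<Union>i<k. ES i) \<union> (\<lambda>i. {w, v i}) ` {..<k}"
        proof (cases "w \<in> e")
          case True
          then obtain u where u: "e = {w, u}" "adjacent E w u"
            using ab adj adjacent_sym[OF adj] by (auto simp: insert_commute)
          obtain i where "i < k" "u = v i" using v_surj[OF u(2)] by blast
          then show ?thesis using u(1) by blast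
        next
          case False
          then have ne: "a \<noteq> w" "b \<noteq> w" using ab by auto
          have "a \<in> V" using adjacent_V[OF adj] by blast
          then obtain i where i: "i < k" "a \<in> VS i" using V ne by blast
          have "b \<in> VS i" unfolding VS_def
          proof (rule br_step[OF _ adj])
            show "{a, b} \<noteq> {w, v i}" using ne by (auto simp: doubleton_eq_iff)
          qed (use i VS_def in simp)
          then have "e \<in> ES i" using i e ab by (simp add: ES_def induced_def)
          then show ?thesis using i by blast
        qed
      qed
      show "(\<Union>i<k. ES i) \<union> (\<lambda>i. {w, v i}) ` {..<k} \<subseteq> E"
        using vw by (auto simp: ES_def induced_def adjacent_def)
    qed
    have vA: "v i \<notin> A" if "i < k" for i using less.prems(2)[OF vw[OF that]] w(2) by blast
    have nbi: "{x. adjacent (ES i) u x} = (if u = v i then nb (v i) - {w} else nb u)"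
      if "i < k" "u \<in> VS i" for i u
      using nb_induced_br[OF vw[OF that(1)], of u] that(2) unfolding ES_def VS_def by blast
    have sub: "VS i \<subseteq> V - {w}" if "i < k" for i
      using br_subset[OF vw[OF that]] br_notin[OF vw[OF that]] by (auto simp: VS_def)
    have viV: "v i \<in> V" if "i < k" for i using adjacent_V[OF vw[OF that]] by blast
    have dv: "card (nb (v i) - {w}) \<le> 1" if "i < k" for i
    proof -
      have "w \<in> nb (v i)" using adjacent_sym[OF vw[OF that]] by simp
      moreover have "card (nb (v i)) \<le> 2"
        using less.prems(4)[OF viV[OF that] vA[OF that]] by (simp add: nb_def)
      ultimately show ?thesis by simp
    qed
    have treei: "tree (VS i) (ES i)" if "i < k" for i
      using tree_br[OF vw[OF that]] by (simp add: VS_def ES_def)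
    have star: "tree_of_stars (VS i) (ES i)" if i: "i < k" for i
    proof (rule less.hyps)
      show "card (VS i) < card V"
        using sub[OF i] w(1) finite_V by (intro psubset_card_mono) auto
      show "tree (VS i) (ES i)" by (rule treei[OF i])
      show "a \<in> A \<longleftrightarrow> b \<notin> A" if "adjacent (ES i) a b" for a b
        using that less.prems(2) unfolding ES_def adjacent_induced by blast
      show "2 \<le> card {x. adjacent (ES i) u x}" if u: "u \<in> VS i" "u \<in> A" for u
      proof -
        have "u \<noteq> v i" using vA[OF i] u(2) by blast
        then show ?thesis
          using nbi[OF i u(1)] less.prems(3)[of u] sub[OF i] u by (auto simp: nb_def)
      qed
      show "card {x. adjacent (ES i) u x} \<le> 2" if u: "u \<in> VS i" "u \<notin> A" for u
        using nbi[OF i u(1)] less.prems(4)[of u] sub[OF i] u dv[OF i] by (auto simp: nb_def)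
    qed
    have leafi: "leaf (VS i) (ES i) (v i)" if i: "i < k" for i
    proof -
      interpret T: tree_graph "VS i" "ES i" by unfold_locales (rule treei[OF i])
      have vi: "v i \<in> VS i" using br_self by (simp add: VS_def)
      have "T.nb (v i) = nb (v i) - {w}" using nbi[OF i vi] by (simp add: T.nb_def)
      then show ?thesis using vi dv[OF i] by (simp add: leaf_def T.degree_eq_card_nb)
    qed
    have "tree_of_stars (insert w (\<Union>i<k. VS i)) ((\<Union>i<k. ES i) \<union> (\<lambda>i. {w, v i}) ` {..<k})"
    proof (rule tree_of_stars.join)
      show "2 \<le> k" using less.prems(3)[OF w] by (simp add: k_def nb_def)
      show "VS i \<inter> VS j = {}" if "i < k" "j < k" "i \<noteq> j" for i j
        using br_children_disjoint[OF vw[OF that(1)] vw[OF that(2)] v_inj[OF that]]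
        by (simp add: VS_def)
      show "w \<notin> (\<Union>i<k. VS i)" using sub by blast
    qed (use star leafi in auto)
    then show ?thesis using V E by simp
  qed
qed

text \<open>By \<open>critical_other\<close> no vertex lies on two edges with both ends core, so
  these edges partition \<open>V\<close> into pairs.\<close>

lemma (in extremal_graph) even_card_if_critical_matching:
  assumes "\<And>v. v \<in> V \<Longrightarrow> \<exists>w. adjacent E v w \<and> cr v w \<and> cr w v"
  shows "even (card V)"
proof -
  define M where "M = {{v, w} | v w. adjacent E v w \<and> cr v w \<and> cr w v}"
  have unique: "w = w'" if "adjacent E v w" "cr v w" "cr w v" "adjacent E v w'" "cr v w'" for v w w'
    using critical_other(1)[OF that(1,2,3,4)] that(5) by blast
  have form: "\<exists>w. c = {v, w} \<and> adjacent E v w \<and> cr v w \<and> cr w v" if c: "c \<in> M" "v \<in> c" for c v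
  proof -
    obtain a b where ab: "c = {a, b}" "adjacent E a b" "cr a b" "cr b a"
      using c(1) unfolding M_def by blast
    then have "v = a \<or> v = b" using c(2) by blast
    then show ?thesis using ab adjacent_sym[OF ab(2)] by (auto simp: insert_commute)
  qed
  have U: "\<Union>M = V"
  proof
    show "\<Union>M \<subseteq> V"
    proof
      fix v assume "v \<in> \<Union>M"
      then obtain w where "adjacent E v w" using form by blast
      then show "v \<in> V" by (rule adjacent_V)
    qed
    show "V \<subseteq> \<Union>M"
    proof
      fix v assume "v \<in> V"
      then obtain w where "adjacent E v w" "cr v w" "cr w v" using assms by blast
      then have "{v, w} \<in> M" unfolding M_def by blast
      then show "v \<in> \<Union>M" by blast
    qed
  qed
  have "2 * card M = card (\<Union>M)"
  proof (rule card_partition)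
    show "finite (\<Union>M)" using U finite_V by simp
    then show "finite M" by (rule finite_UnionD)
    show "card c = 2" if c: "c \<in> M" for c
      using c adjacent_V(3) unfolding M_def by (auto simp: card_insert_if)
    show "c \<inter> c' = {}" if c: "c \<in> M" "c' \<in> M" "c \<noteq> c'" for c c'
    proof (rule ccontr)
      assume "c \<inter> c' \<noteq> {}"
      then obtain v where v: "v \<in> c" "v \<in> c'" by blast
      obtain w where w: "c = {v, w}" "adjacent E v w" "cr v w" "cr w v"
        using form[OF c(1) v(1)] by blast
      obtain w' where w': "c' = {v, w'}" "adjacent E v w'" "cr v w'"
        using form[OF c(2) v(2)] by blast
      show False using unique[OF w(2-4) w'(2,3)] w(1) w'(1) c(3) by blast
    qed
  qed
  then show ?thesis using U by (metis dvd_triv_left)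
qed

theorem theorem1:
  fixes V :: "'a set" and E :: "'a set set"
  assumes "extremal_tree V E"
  shows "tree_of_stars V E \<or> (path_graph V E \<and> odd (card E))"
proof -
  interpret extremal_graph V E
    using assms by unfold_locales (simp_all add: extremal_tree_def)
  show ?thesis
  proof (cases "\<exists>a b. adjacent E a b \<and> (cr a b \<longleftrightarrow> cr b a)")
    case True
    then obtain a b where ab: "adjacent E a b" "cr a b \<longleftrightarrow> cr b a" by blast
    have mate: "\<exists>w. adjacent E v w \<and> cr v w \<and> cr w v" and deg: "card (nb v) \<le> 2" if "v \<in> V" for v
      using unoriented_all[OF ab that] by blast+
    obtain l p where l: "l \<in> br a b" "nb l = {p}" using leaf_in_br[OF ab(1)] .
    have "l \<in> V" using l(1) br_subset[OF ab(1)] by blast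
    then obtain xs where xs: "xs \<noteq> []" "distinct xs" "V = set xs"
      "E = {{xs ! i, xs ! Suc i} | i. Suc i < length xs}" "Suc (card E) = card V"
      using tree_max_degree_2_path[OF tree, of l] l(2) deg unfolding nb_def by auto
    have "even (Suc (card E))" using even_card_if_critical_matching[OF mate] xs(5) by simp
    moreover have "path_graph V E" unfolding path_graph_def using xs(1-4) by blast
    ultimately show ?thesis by simp
  next
    case False
    then have oriented: "\<And>a b. adjacent E a b \<Longrightarrow> cr a b \<longleftrightarrow> \<not> cr b a" by blast
    have "card (nb v) \<le> 2" if "v \<notin> hubs" for v
      using core_degree_le_2[OF oriented, of v] that unfolding hubs_def by blast
    then have "tree_of_stars V E"
      using bipartite_tree_of_stars[OF tree hubs_bipartite[OF oriented]] hubs_degree[OF oriented]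
      unfolding nb_def by blast
    then show ?thesis ..
  qed
qed

end
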